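(* Let $\mathcal{F}$ be a Fraïssé structure in a relational language such that $\mathrm{Age}(\mathcal{F})$ has the free joint embedding property, let $G=\mathrm{Aut}(\mathcal{F})$, let $\mathcal{A}\subseteq\mathrm{RUC}_b(G)$ be the algebra of null functions, and let $\varepsilon>0$. Then $\mathcal{F}$ has the Ramsey property up to $2\varepsilon$ for the finite colourings in $(\mathcal{A})_\varepsilon$: for all $A,B\in\mathrm{Age}(\mathcal{F})$ and every finite set $C$ of finite colourings of $\binom{\mathcal{F}}{A}$ which belong to $(\mathcal{A})_\varepsilon$, there exists $h\in\binom{\mathcal{F}}{B}$ such that for every $\chi\in C$ and all $a,a'\in\binom{B}{A}$, $|\chi(h\circ a)-\chi(h\circ a')|\le 2\varepsilon$.
   Context: A Fraïssé structure is a countable relational structure $\mathcal{F}$ which is ultrahomogeneous (every isomorphism between finite substructures extends to an automorphism); $\mathrm{Age}(\mathcal{F})$ is the class of finite structures embeddable in $\mathcal{F}$. The free joint embedding property: for $A,B\in\mathrm{Age}(\mathcal{F})$ the disjoint union $A\sqcup B$ with no relations between elements of $A$ and elements of $B$ (a relation holds iff all arguments lie in $A$ and it holds there, or all lie in $B$ and it holds there) is in $\mathrm{Age}(\mathcal{F})$. $G$ carries the pointwise convergence topology. $\binom{Y}{A}$ denotes the set of embeddings of $A$ into $Y$. A colouring of $\binom{\mathcal{F}}{A}$ is a function $\chi\colon\binom{\mathcal{F}}{A}\to\mathbb R$, finite if its image is finite; fixing an embedding $a_0\in\binom{\mathcal{F}}{A}$ (so $\binom{\mathcal{F}}{A}=\{g\circ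 a_0: g\in G\}$ by ultrahomogeneity), $\chi$ is identified with the function $\bar\chi\colon G\to\mathbb R$, $\bar\chi(g)=\chi(g\circ a_0)$. $G$ acts on itself by left multiplication. $\mathrm{RUC}_b(G)$ is the algebra of bounded $f\colon G\to\mathbb R$ such that for every $\delta>0$ there is a neighbourhood $U$ of the identity with $|f(g^{-1}x)-f(x)|<\delta$ for all $g\in U$, $x\in G$, with the sup norm. A $G$-compactification of $G$ is a dense embedding $\nu\colon G\to Y$ into a compact space $Y$ to which the left action extends continuously; $f$ comes from $\nu$ if $f=\tilde f\circ\nu$ for some continuous $\tilde f$ on $Y$. For a $G$-flow $Y$ (compact space with continuous $G$-action) and $A_0,A_1\subseteq Y$, an independence set for $\{A_0,A_1\}$ is $I\subseteq G$ such that $\bigcap_{j\in J}j^{-1}A_{\sigma(j)}\ne\varnothing$ for every finite $J\subseteq I$ and $\sigma\colon J\to\{0,1\}$; an IN-pair is $(x,y)\in Y^2$ such that for all neighbourhoods $U_0\ni x,U_1\ni y$ and all $n$, $\{U_0,U_1\}$ has an independence set of size $\ge n$; $Y$ is null if there is no continuous $f$ on $Y$ and IN-pair $(x,y)$, $x\ne y$, with $f(x)\ne f(y)$. A function $f\in\mathrm{RUC}_b(G)$ is null if it comes from some $G$-compactification $\nu\colon G\to Y$ with $Y$ null. $(\mathcal{A})_\varepsilon$ is the set of functions $G\to\mathbb R$ at sup-distance less than $\varepsilon$ from some element of $\mathcal{A}$. *)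

theory Defs
  imports "HOL-Analysis.Analysis" "HOL-Combinatorics.Permutations"
begin

section \<open>Relational structures\<close>

text \<open>
  A relational language is a type \<open>'r\<close> of relation symbols with an arity function
  \<open>ar :: 'r \<Rightarrow> nat\<close>. Only the values of \<open>interp M r\<close> on lists of length \<open>ar r\<close> with entries in
  \<open>carr M\<close> are meaningful; the definitions below never look at any other value.
\<close>

record ('r, 'a) rel_structure =
  carr :: "'a set"
  interp :: "'r \<Rightarrow> 'a list \<Rightarrow> bool"

definition preserves_rels ::
  "('r \<Rightarrow> nat) \<Rightarrow> ('r, 'a) rel_structure \<Rightarrow> ('r, 'b) rel_structure \<Rightarrow> ('a \<Rightarrow> 'b) \<Rightarrow> bool" where
  "preserves_rels ar M N f \<longleftrightarrow>
     (\<forall>r xs. length xs = ar r \<and> set xs \<subseteq> carr M \<longrightarrow> (interp M r xs \<longleftrightarrow> interp N r (map f xs)))"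

text \<open>Embeddings are extensional (\<open>undefined\<close> outside the domain), so that distinct elements of
  this set are distinct as embeddings; composites are accordingly formed with
  \<open>compose (carr M)\<close>.\<close>

definition embeddings ::
  "('r \<Rightarrow> nat) \<Rightarrow> ('r, 'a) rel_structure \<Rightarrow> ('r, 'b) rel_structure \<Rightarrow> ('a \<Rightarrow> 'b) set" where
  "embeddings ar M N =
     {f \<in> carr M \<rightarrow>\<^sub>E carr N. inj_on f (carr M) \<and> preserves_rels ar M N f}"

definition isomorphisms ::
  "('r \<Rightarrow> nat) \<Rightarrow> ('r, 'a) rel_structure \<Rightarrow> ('r, 'b) rel_structure \<Rightarrow> ('a \<Rightarrow> 'b) set" where
  "isomorphisms ar M N = {f \<in> embeddings ar M N. f ` carr M = carr N}"

definition substructure :: "('r, 'a) rel_structure \<Rightarrow> 'a set \<Rightarrow> ('r, 'a) rel_structure" where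
  "substructure M S = M\<lparr>carr := S\<rparr>"

text \<open>Automorphisms are extended by the identity outside the domain, so that the group operations
  are \<open>(\<circ>)\<close>, \<open>id\<close> and \<open>inv\<close>.\<close>

definition Aut :: "('r \<Rightarrow> nat) \<Rightarrow> ('r, 'a) rel_structure \<Rightarrow> ('a \<Rightarrow> 'a) set" where
  "Aut ar M = {g. g permutes carr M \<and> preserves_rels ar M M g}"

definition ultrahomogeneous :: "('r \<Rightarrow> nat) \<Rightarrow> ('r, 'a) rel_structure \<Rightarrow> bool" where
  "ultrahomogeneous ar M \<longleftrightarrow>
     (\<forall>S T f. finite S \<and> S \<subseteq> carr M \<and> finite T \<and> T \<subseteq> carr M \<and>
        f \<in> isomorphisms ar (substructure M S) (substructure M T) \<longrightarrow>
        (\<exists>g\<in>Aut ar M. \<forall>x\<in>S. g x = f x))"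

definition Fraisse_structure :: "('r \<Rightarrow> nat) \<Rightarrow> ('r, 'a) rel_structure \<Rightarrow> bool" where
  "Fraisse_structure ar F \<longleftrightarrow> countable (carr F) \<and> ultrahomogeneous ar F"

definition in_Age :: "('r \<Rightarrow> nat) \<Rightarrow> ('r, 'a) rel_structure \<Rightarrow> ('r, 'b) rel_structure \<Rightarrow> bool" where
  "in_Age ar F M \<longleftrightarrow> finite (carr M) \<and> embeddings ar M F \<noteq> {}"

definition free_union ::
  "('r, 'a) rel_structure \<Rightarrow> ('r, 'b) rel_structure \<Rightarrow> ('r, 'a + 'b) rel_structure" where
  "free_union M N =
     \<lparr>carr = carr M <+> carr N,
      interp = (\<lambda>r xs. (\<exists>ys. xs = map Inl ys \<and> interp M r ys) \<or>
                       (\<exists>zs. xs = map Inr zs \<and> interp N r zs))\<rparr>"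

text \<open>The quantifiers range over structures living on the type of \<open>F\<close>; as every member of the age is
  isomorphic to a substructure of \<open>F\<close>, this is no restriction (\<open>free_JEP_arbitrary_types\<close>).\<close>

definition free_JEP :: "('r \<Rightarrow> nat) \<Rightarrow> ('r, 'a) rel_structure \<Rightarrow> bool" where
  "free_JEP ar F \<longleftrightarrow>
     (\<forall>(M :: ('r, 'a) rel_structure) (N :: ('r, 'a) rel_structure).
        in_Age ar F M \<and> in_Age ar F N \<longrightarrow> in_Age ar F (free_union M N))"

lemma free_JEP_arbitrary_types:
  fixes M :: "('r, 'b) rel_structure" and N :: "('r, 'c) rel_structure"
    and F :: "('r, 'a) rel_structure"
  assumes F: "free_JEP ar F" and M: "in_Age ar F M" and N: "in_Age ar F N"
  shows "in_Age ar F (free_union M N)"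
proof -
  obtain f where f: "f \<in> embeddings ar M F" and finM: "finite (carr M)"
    using M unfolding in_Age_def by blast
  obtain g where g: "g \<in> embeddings ar N F" and finN: "finite (carr N)"
    using N unfolding in_Age_def by blast
  define M' where "M' = substructure F (f ` carr M)"
  define N' where "N' = substructure F (g ` carr N)"
  have fF: "f ` carr M \<subseteq> carr F" and gF: "g ` carr N \<subseteq> carr F"
    using f g by (auto simp: embeddings_def)
  have sub: "in_Age ar F (substructure F S)" if "finite S" "S \<subseteq> carr F" for S
  proof -
    have "restrict id S \<in> embeddings ar (substructure F S) F"
    proof -
      have "map (restrict id S) xs = xs" if "set xs \<subseteq> S" for xs
        using that by (intro map_idI) auto
      then show ?thesis
        using that by (auto simp: embeddings_def substructure_def preserves_rels_def inj_on_def)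
    qed
    then show ?thesis
      using that by (auto simp: in_Age_def substructure_def)
  qed
  have "in_Age ar F (free_union M' N')"
    using F sub[of "f ` carr M"] sub[of "g ` carr N"] finM finN fF gF
    unfolding free_JEP_def M'_def N'_def by blast
  then obtain h where h: "h \<in> embeddings ar (free_union M' N') F"
    unfolding in_Age_def by blast
  define k where "k = restrict (h \<circ> map_sum f g) (carr M <+> carr N)"
  have inj: "inj_on (map_sum f g) (carr M <+> carr N)"
  proof -
    have "inj_on f (carr M)" "inj_on g (carr N)"
      using f g by (simp_all add: embeddings_def)
    then show ?thesis by (intro inj_onI) (auto dest: inj_onD)
  qed
  have img: "map_sum f g ` (carr M <+> carr N) = carr (free_union M' N')"
    by (force simp: free_union_def M'_def N'_def substructure_def image_iff Plus_def)
  have domU: "carr (free_union M N) = carr M <+> carr N"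
    by (simp add: free_union_def)
  have rel: "interp (free_union M N) r xs \<longleftrightarrow>
      interp (free_union M' N') r (map (map_sum f g) xs)"
    if len: "length xs = ar r" and sub: "set xs \<subseteq> carr M <+> carr N" for r xs
  proof -
    have L: "xs = map Inl (map projl xs)" if "map (map_sum f g) xs = map Inl ys" for ys
    proof -
      have "\<forall>x\<in>set xs. isl x"
      proof
        fix x assume "x \<in> set xs"
        then have "map_sum f g x \<in> set (map Inl ys)"
          unfolding that[symmetric] by simp
        then show "isl x" by (cases x) auto
      qed
      then show ?thesis by (simp add: map_idI)
    qed
    have R: "xs = map Inr (map projr xs)" if "map (map_sum f g) xs = map Inr ys" for ys
    proof -
      have "\<forall>x\<in>set xs. \<not> isl x"
      proof
        fix x assume "x \<in> set xs"
        then have "map_sum f g x \<in> set (map Inr ys)"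
          unfolding that[symmetric] by simp
        then show "\<not> isl x" by (cases x) auto
      qed
      then show ?thesis by (simp add: map_idI)
    qed
    have IL: "interp M r ys \<longleftrightarrow> interp F r (map f ys)" if "xs = map Inl ys" for ys
    proof -
      have "length ys = ar r" "set ys \<subseteq> carr M" using len sub that by auto
      then show ?thesis using f unfolding embeddings_def preserves_rels_def by blast
    qed
    have IR: "interp N r ys \<longleftrightarrow> interp F r (map g ys)" if "xs = map Inr ys" for ys
    proof -
      have "length ys = ar r" "set ys \<subseteq> carr N" using len sub that by auto
      then show ?thesis using g unfolding embeddings_def preserves_rels_def by blast
    qed
    have EL: "map (map_sum f g) (map Inl ys) = map Inl (map f ys)" for ys
      by simp
    have ER: "map (map_sum f g) (map Inr ys) = map Inr (map g ys)" for ys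
      by simp
    have injL: "ys = zs" if "map Inl ys = (map Inl zs :: ('a + 'a) list)" for ys zs
      using that by simp
    have injR: "ys = zs" if "map Inr ys = (map Inr zs :: ('a + 'a) list)" for ys zs
      using that by simp
    have "(\<exists>ys. xs = map Inl ys \<and> interp M r ys) \<longleftrightarrow>
        (\<exists>zs. map (map_sum f g) xs = map Inl zs \<and> interp F r zs)"
    proof
      assume "\<exists>ys. xs = map Inl ys \<and> interp M r ys"
      then show "\<exists>zs. map (map_sum f g) xs = map Inl zs \<and> interp F r zs"
        using IL EL by blast
    next
      assume "\<exists>zs. map (map_sum f g) xs = map Inl zs \<and> interp F r zs"
      then obtain zs where zs: "map (map_sum f g) xs = map Inl zs" "interp F r zs" by blast
      have x: "xs = map Inl (map projl xs)" using L[OF zs(1)] .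
      have "zs = map f (map projl xs)"
        using arg_cong[OF x, of "map (map_sum f g)"] unfolding EL zs(1) by (rule injL)
      then have "interp M r (map projl xs)" using IL[OF x] zs(2) by blast
      then show "\<exists>ys. xs = map Inl ys \<and> interp M r ys" using x by blast
    qed
    moreover have "(\<exists>ys. xs = map Inr ys \<and> interp N r ys) \<longleftrightarrow>
        (\<exists>zs. map (map_sum f g) xs = map Inr zs \<and> interp F r zs)"
    proof
      assume "\<exists>ys. xs = map Inr ys \<and> interp N r ys"
      then show "\<exists>zs. map (map_sum f g) xs = map Inr zs \<and> interp F r zs"
        using IR ER by blast
    next
      assume "\<exists>zs. map (map_sum f g) xs = map Inr zs \<and> interp F r zs"
      then obtain zs where zs: "map (map_sum f g) xs = map Inr zs" "interp F r zs" by blast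
      have x: "xs = map Inr (map projr xs)" using R[OF zs(1)] .
      have "zs = map g (map projr xs)"
        using arg_cong[OF x, of "map (map_sum f g)"] unfolding ER zs(1) by (rule injR)
      then have "interp N r (map projr xs)" using IR[OF x] zs(2) by blast
      then show "\<exists>ys. xs = map Inr ys \<and> interp N r ys" using x by blast
    qed
    ultimately show ?thesis
      by (simp add: free_union_def M'_def N'_def substructure_def)
  qed
  have "k \<in> embeddings ar (free_union M N) F"
  proof -
    have "k \<in> carr (free_union M N) \<rightarrow>\<^sub>E carr F"
    proof -
      have "h (map_sum f g x) \<in> carr F" if "x \<in> carr M <+> carr N" for x
      proof -
        have "map_sum f g x \<in> carr (free_union M' N')" using that unfolding img[symmetric] by (rule imageI)
        moreover have "h \<in> carr (free_union M' N') \<rightarrow> carr F"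
          using h by (simp add: embeddings_def PiE_def)
        ultimately show ?thesis by (rule funcset_mem[rotated])
      qed
      then show ?thesis
        unfolding k_def domU by (simp add: PiE_def Pi_def)
    qed
    moreover have "inj_on k (carr (free_union M N))"
    proof -
      have "inj_on (h \<circ> map_sum f g) (carr M <+> carr N)"
        using h inj img by (intro comp_inj_on) (simp_all only: img, simp add: embeddings_def)
      then show ?thesis
        unfolding k_def domU by (simp only: inj_on_restrict_eq)
    qed
    moreover have "preserves_rels ar (free_union M N) F k"
      unfolding preserves_rels_def domU
    proof (intro allI impI)
      fix r xs assume xs: "length xs = ar r \<and> set xs \<subseteq> carr M <+> carr N"
      have km: "map k xs = map h (map (map_sum f g) xs)"
        using xs by (auto simp: k_def)
      have "set (map (map_sum f g) xs) \<subseteq> carr (free_union M' N')"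
        using xs unfolding img[symmetric] set_map by blast
      then have "interp (free_union M' N') r (map (map_sum f g) xs) \<longleftrightarrow> interp F r (map k xs)"
        using h xs unfolding km embeddings_def preserves_rels_def by (simp del: map_map)
      then show "interp (free_union M N) r xs \<longleftrightarrow> interp F r (map k xs)"
        using rel xs by blast
    qed
    ultimately show ?thesis by (simp add: embeddings_def)
  qed
  then show ?thesis
    using finM finN by (auto simp: in_Age_def domU)
qed


section \<open>Flows and compactifications\<close>

text \<open>Throughout, \<open>G\<close> is a group of permutations of \<open>'a\<close> under composition. Functions on \<open>G\<close> are
  total functions of which only the values on \<open>G\<close> matter.\<close>

definition pointwise_topology :: "('a \<Rightarrow> 'a) set \<Rightarrow> ('a \<Rightarrow> 'a) topology" where
  "pointwise_topology G =
     subtopology (product_topology (\<lambda>_. discrete_topology UNIV) UNIV) G"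

definition RUCb :: "('a \<Rightarrow> 'a) set \<Rightarrow> (('a \<Rightarrow> 'a) \<Rightarrow> real) set" where
  "RUCb G =
     {f. bounded (f ` G) \<and>
         (\<forall>\<delta>>0. \<exists>U. openin (pointwise_topology G) U \<and> id \<in> U \<and>
            (\<forall>g\<in>U. \<forall>x\<in>G. \<bar>f (inv g \<circ> x) - f x\<bar> < \<delta>))}"

text \<open>Compact spaces are Hausdorff by convention.\<close>

definition G_flow ::
  "('a \<Rightarrow> 'a) set \<Rightarrow> 'y topology \<Rightarrow> (('a \<Rightarrow> 'a) \<Rightarrow> 'y \<Rightarrow> 'y) \<Rightarrow> bool" where
  "G_flow G Y act \<longleftrightarrow>
     compact_space Y \<and> Hausdorff_space Y \<and>
     continuous_map (prod_topology (pointwise_topology G) Y) Y (\<lambda>(g, y). act g y) \<and>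
     (\<forall>y\<in>topspace Y. act id y = y) \<and>
     (\<forall>g\<in>G. \<forall>h\<in>G. \<forall>y\<in>topspace Y. act (g \<circ> h) y = act g (act h y))"

definition G_compactification ::
  "('a \<Rightarrow> 'a) set \<Rightarrow> 'y topology \<Rightarrow> (('a \<Rightarrow> 'a) \<Rightarrow> 'y \<Rightarrow> 'y) \<Rightarrow> (('a \<Rightarrow> 'a) \<Rightarrow> 'y) \<Rightarrow> bool" where
  "G_compactification G Y act \<nu> \<longleftrightarrow>
     G_flow G Y act \<and>
     embedding_map (pointwise_topology G) Y \<nu> \<and>
     Y closure_of (\<nu> ` G) = topspace Y \<and>
     (\<forall>g\<in>G. \<forall>x\<in>G. act g (\<nu> x) = \<nu> (g \<circ> x))"

text \<open>\<open>\<sigma> j = False\<close> and \<open>\<sigma> j = True\<close> select \<open>A\<^sub>0\<close> and \<open>A\<^sub>1\<close> respectively.\<close>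

definition independence_set ::
  "('a \<Rightarrow> 'a) set \<Rightarrow> (('a \<Rightarrow> 'a) \<Rightarrow> 'y \<Rightarrow> 'y) \<Rightarrow> 'y set \<Rightarrow> 'y set \<Rightarrow> ('a \<Rightarrow> 'a) set \<Rightarrow> bool" where
  "independence_set G act A0 A1 I \<longleftrightarrow>
     I \<subseteq> G \<and>
     (\<forall>J \<sigma>. finite J \<and> J \<subseteq> I \<longrightarrow> (\<Inter>j\<in>J. act (inv j) ` (if \<sigma> j then A1 else A0)) \<noteq> {})"

definition IN_pair ::
  "('a \<Rightarrow> 'a) set \<Rightarrow> 'y topology \<Rightarrow> (('a \<Rightarrow> 'a) \<Rightarrow> 'y \<Rightarrow> 'y) \<Rightarrow> 'y \<Rightarrow> 'y \<Rightarrow> bool" where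
  "IN_pair G Y act x y \<longleftrightarrow>
     x \<in> topspace Y \<and> y \<in> topspace Y \<and>
     (\<forall>U0 U1. openin Y U0 \<and> x \<in> U0 \<and> openin Y U1 \<and> y \<in> U1 \<longrightarrow>
        (\<forall>n. \<exists>I. independence_set G act U0 U1 I \<and> (infinite I \<or> n \<le> card I)))"

definition null_flow ::
  "('a \<Rightarrow> 'a) set \<Rightarrow> 'y topology \<Rightarrow> (('a \<Rightarrow> 'a) \<Rightarrow> 'y \<Rightarrow> 'y) \<Rightarrow> bool" where
  "null_flow G Y act \<longleftrightarrow>
     \<not> (\<exists>f x y. continuous_map Y euclideanreal f \<and> IN_pair G Y act x y \<and> x \<noteq> y \<and> f x \<noteq> f y)"

definition comes_from ::
  "('a \<Rightarrow> 'a) set \<Rightarrow> (('a \<Rightarrow> 'a) \<Rightarrow> real) \<Rightarrow> 'y topology \<Rightarrow> (('a \<Rightarrow> 'a) \<Rightarrow> 'y) \<Rightarrow> bool" where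
  "comes_from G f Y \<nu> \<longleftrightarrow>
     (\<exists>f'. continuous_map Y euclideanreal f' \<and> (\<forall>g\<in>G. f g = f' (\<nu> g)))"

text \<open>
  A formula cannot quantify over types, so the compactification is taken on the fixed type
  \<open>('a \<Rightarrow> 'a) set set\<close>. This loses nothing: a point \<open>y\<close> of a Hausdorff compactification of \<open>G\<close> is
  determined by the trace on \<open>G\<close> of its neighbourhood filter, so a compactification on any type
  has an isomorphic copy on \<open>('a \<Rightarrow> 'a) set set\<close>; see \<open>null_functions_arbitrary_type\<close>.
\<close>

definition null_functions :: "('a \<Rightarrow> 'a) set \<Rightarrow> (('a \<Rightarrow> 'a) \<Rightarrow> real) set" where
  "null_functions G =
     {f \<in> RUCb G. \<exists>(Y :: ('a \<Rightarrow> 'a) set set topology) act \<nu>.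
        G_compactification G Y act \<nu> \<and> null_flow G Y act \<and> comes_from G f Y \<nu>}"

lemma null_functions_arbitrary_type:
  fixes Y :: "'y topology" and G :: "('a \<Rightarrow> 'a) set"
  assumes f: "f \<in> RUCb G" and comp: "G_compactification G Y act \<nu>"
    and null: "null_flow G Y act" and from_Y: "comes_from G f Y \<nu>"
    and inv_closed: "\<And>g. g \<in> G \<Longrightarrow> inv g \<in> G"
  shows "f \<in> null_functions G"
proof -
  have flow: "G_flow G Y act" and emb: "embedding_map (pointwise_topology G) Y \<nu>"
    and dense: "Y closure_of (\<nu> ` G) = topspace Y"
    and equiv: "\<And>g x. \<lbrakk>g \<in> G; x \<in> G\<rbrakk> \<Longrightarrow> act g (\<nu> x) = \<nu> (g \<circ> x)"
    using comp unfolding G_compactification_def by auto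
  have topG: "topspace (pointwise_topology G) = G"
    by (simp add: pointwise_topology_def)
  have cY: "compact_space Y" and hY: "Hausdorff_space Y"
    and cact: "continuous_map (prod_topology (pointwise_topology G) Y) Y (\<lambda>(g, y). act g y)"
    and act_id: "\<And>y. y \<in> topspace Y \<Longrightarrow> act id y = y"
    and act_comp: "\<And>g h y. \<lbrakk>g \<in> G; h \<in> G; y \<in> topspace Y\<rbrakk> \<Longrightarrow> act (g \<circ> h) y = act g (act h y)"
    using flow unfolding G_flow_def by blast+
  have act_in: "act g y \<in> topspace Y" if "g \<in> G" "y \<in> topspace Y" for g y
    using continuous_map_image_subset_topspace[OF cact] that topG by force
  have nu_in: "\<nu> g \<in> topspace Y" if "g \<in> G" for g
  proof -
    have "\<nu> ` G \<subseteq> topspace Y"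
      using homeomorphic_imp_surjective_map[OF emb[unfolded embedding_map_def]] topG
      by (metis inf.cobounded1 topspace_subtopology)
    then show ?thesis using that by blast
  qed
  define e where "e y = {N. \<exists>U. openin Y U \<and> y \<in> U \<and> {g\<in>G. \<nu> g \<in> U} \<subseteq> N}" for y
  define Z where "Z = topspace Y"
  define d where "d = inv_into Z e"
  have inj: "inj_on e Z"
  proof (rule inj_onI, rule ccontr)
    fix x y assume xy: "x \<in> Z" "y \<in> Z" "e x = e y" "x \<noteq> y"
    then obtain U V where UV: "openin Y U" "openin Y V" "x \<in> U" "y \<in> V" "disjnt U V"
      using hY unfolding Hausdorff_space_def Z_def by metis
    have "{g\<in>G. \<nu> g \<in> U} \<in> e y"
      using UV xy(3)[symmetric] unfolding e_def by blast
    then obtain W where W: "openin Y W" "y \<in> W" "{g\<in>G. \<nu> g \<in> W} \<subseteq> {g\<in>G. \<nu> g \<in> U}"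
      unfolding e_def by blast
    have "openin Y (V \<inter> W)" "y \<in> V \<inter> W" using UV W by auto
    moreover have "y \<in> Y closure_of (\<nu> ` G)" using dense xy Z_def by simp
    ultimately obtain g where "g \<in> G" "\<nu> g \<in> V \<inter> W"
      unfolding in_closure_of by blast
    then show False using W UV unfolding disjnt_def by blast
  qed
  have de: "d (e y) = y" if "y \<in> Z" for y
    using inj that by (simp add: d_def)
  have dZ: "d z \<in> Z" and ed: "e (d z) = z" if "z \<in> e ` Z" for z
    using that by (auto simp: d_def inv_into_into f_inv_into_f)
  define Y' where "Y' = pullback_topology (e ` Z) d Y"
  have top': "topspace Y' = e ` Z"
    using dZ by (auto simp: Y'_def topspace_pullback_topology Z_def)
  have cd: "continuous_map Y' Y d"
    unfolding continuous_map_alt top' Y'_def openin_pullback_topology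
    using dZ by (auto simp: topspace_pullback_topology Z_def)
  have ce: "continuous_map Y Y' e"
    unfolding continuous_map_def top'
  proof (intro conjI allI impI)
    show "e \<in> topspace Y \<rightarrow> e ` Z" by (auto simp: Z_def)
    fix U assume "openin Y' U"
    then obtain V where V: "openin Y V" "U = d -` V \<inter> e ` Z"
      unfolding Y'_def openin_pullback_topology by blast
    have "{x \<in> topspace Y. e x \<in> U} = V"
      using V openin_subset[OF V(1)] de by (auto simp: Z_def)
    then show "openin Y {x \<in> topspace Y. e x \<in> U}" using V by simp
  qed
  have hmaps: "homeomorphic_maps Y Y' e d"
    unfolding homeomorphic_maps_def using cd ce de ed by (auto simp: top' Z_def)
  then have hm: "homeomorphic_map Y Y' e"
    using homeomorphic_maps_map by blast
  then have hs: "Y homeomorphic_space Y'"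
    using homeomorphic_map_imp_homeomorphic_space by blast
  define act' where "act' g z = e (act g (d z))" for g z
  define \<nu>' where "\<nu>' = e \<circ> \<nu>"
  have flow': "G_flow G Y' act'"
    unfolding G_flow_def
  proof (intro conjI ballI)
    show "compact_space Y'" using cY hs homeomorphic_compact_space by blast
    show "Hausdorff_space Y'" using hY hs homeomorphic_Hausdorff_space by blast
    have "continuous_map (prod_topology (pointwise_topology G) Y')
        (prod_topology (pointwise_topology G) Y) (\<lambda>p. (fst p, d (snd p)))"
      by (intro continuous_map_pairedI continuous_map_fst
          continuous_map_compose[OF continuous_map_snd cd, unfolded comp_def])
    then have "continuous_map (prod_topology (pointwise_topology G) Y') Y'
        (e \<circ> (\<lambda>(g, y). act g y) \<circ> (\<lambda>p. (fst p, d (snd p))))"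
      using continuous_map_compose[OF _ continuous_map_compose[OF cact ce]] by blast
    then show "continuous_map (prod_topology (pointwise_topology G) Y') Y' (\<lambda>(g, y). act' g y)"
      by (simp add: comp_def act'_def case_prod_unfold)
  next
    fix y assume "y \<in> topspace Y'"
    then show "act' id y = y"
      using act_id dZ ed by (simp add: act'_def top' Z_def)
  next
    fix g h y assume "g \<in> G" "h \<in> G" "y \<in> topspace Y'"
    then show "act' (g \<circ> h) y = act' g (act' h y)"
      using act_comp dZ de act_in by (simp add: act'_def top' Z_def)
  qed
  have comp': "G_compactification G Y' act' \<nu>'"
    unfolding G_compactification_def
  proof (intro conjI ballI flow')
    show "embedding_map (pointwise_topology G) Y' \<nu>'"
      unfolding \<nu>'_def
      using embedding_map_compose[OF emb surjective_embedding_map[THEN iffD2, THEN conjunct1, OF hm]] .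
    have "Y' closure_of (e ` (\<nu> ` G)) = e ` (Y closure_of (\<nu> ` G))"
      using homeomorphic_map_closure_of[OF hm] nu_in by blast
    then show "Y' closure_of (\<nu>' ` G) = topspace Y'"
      by (simp add: \<nu>'_def image_comp dense top' Z_def)
  next
    fix g x assume "g \<in> G" "x \<in> G"
    then show "act' g (\<nu>' x) = \<nu>' (g \<circ> x)"
      using equiv de nu_in by (simp add: act'_def \<nu>'_def Z_def)
  qed
  have indep: "independence_set G act U0 U1 I"
    if I: "independence_set G act' (e ` U0) (e ` U1) I" and U: "U0 \<subseteq> Z" "U1 \<subseteq> Z" for U0 U1 I
    unfolding independence_set_def
  proof (intro conjI allI impI)
    show "I \<subseteq> G" using I unfolding independence_set_def by blast
    fix J and \<sigma> :: "('a \<Rightarrow> 'a) \<Rightarrow> bool" assume J: "finite J \<and> J \<subseteq> I"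
    then obtain z where z: "z \<in> (\<Inter>j\<in>J. act' (inv j) ` (if \<sigma> j then e ` U1 else e ` U0))"
      using I unfolding independence_set_def by blast
    have "d z \<in> act (inv j) ` (if \<sigma> j then U1 else U0)" if j: "j \<in> J" for j
    proof -
      have "z \<in> act' (inv j) ` e ` (if \<sigma> j then U1 else U0)"
        using z j by (auto split: if_splits)
      then obtain u where u: "u \<in> (if \<sigma> j then U1 else U0)" "z = act' (inv j) (e u)"
        by blast
      have uZ: "u \<in> Z" using u U by (auto split: if_splits)
      have "inv j \<in> G" using j J \<open>I \<subseteq> G\<close> inv_closed by blast
      then have "d z = act (inv j) u"
        using u uZ de act_in by (simp add: act'_def Z_def)
      then show ?thesis using u by blast
    qed
    then show "(\<Inter>j\<in>J. act (inv j) ` (if \<sigma> j then U1 else U0)) \<noteq> {}" by blast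
  qed
  have IN: "IN_pair G Y act (d x) (d y)" if xy: "IN_pair G Y' act' x y" for x y
    unfolding IN_pair_def
  proof (intro conjI allI impI)
    have x: "x \<in> e ` Z" and y: "y \<in> e ` Z"
      using xy unfolding IN_pair_def top' by auto
    show "d x \<in> topspace Y" "d y \<in> topspace Y" using x y dZ Z_def by auto
    fix U0 U1 n assume U: "openin Y U0 \<and> d x \<in> U0 \<and> openin Y U1 \<and> d y \<in> U1"
    have sub: "U0 \<subseteq> Z" "U1 \<subseteq> Z" using U openin_subset Z_def by auto
    have op: "openin Y' (e ` U0)" "openin Y' (e ` U1)"
      using U hm homeomorphic_map_openness_eq by blast+
    have mem: "x \<in> e ` U0" "y \<in> e ` U1" using U imageI[of "d x" U0 e] imageI[of "d y" U1 e] ed[OF x] ed[OF y] by simp_all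
    show "\<exists>I. independence_set G act U0 U1 I \<and> (infinite I \<or> n \<le> card I)"
    proof -
      obtain I where "independence_set G act' (e ` U0) (e ` U1) I" "infinite I \<or> n \<le> card I"
        using xy op mem unfolding IN_pair_def by blast
      then show ?thesis using indep[OF _ sub] by blast
    qed
  qed
  have null': "null_flow G Y' act'"
    unfolding null_flow_def
  proof
    assume "\<exists>q x y. continuous_map Y' euclideanreal q \<and> IN_pair G Y' act' x y \<and> x \<noteq> y \<and> q x \<noteq> q y"
    then obtain q x y where q: "continuous_map Y' euclideanreal q" "IN_pair G Y' act' x y" "q x \<noteq> q y"
      by blast
    have xy: "x \<in> e ` Z" "y \<in> e ` Z" using q unfolding IN_pair_def top' by auto
    have "continuous_map Y euclideanreal (q \<circ> e)"
      using continuous_map_compose[OF ce q(1)] .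
    moreover have "(q \<circ> e) (d x) \<noteq> (q \<circ> e) (d y)" using q ed xy by simp
    ultimately show False using null IN[OF q(2)] unfolding null_flow_def by metis
  qed
  have "comes_from G f Y' \<nu>'"
  proof -
    obtain f' where f': "continuous_map Y euclideanreal f'" "\<And>g. g \<in> G \<Longrightarrow> f g = f' (\<nu> g)"
      using from_Y unfolding comes_from_def by blast
    have "continuous_map Y' euclideanreal (f' \<circ> d)"
      using continuous_map_compose[OF cd f'(1)] .
    moreover have "\<forall>g\<in>G. f g = (f' \<circ> d) (\<nu>' g)"
      using f' de nu_in by (simp add: \<nu>'_def Z_def)
    ultimately show ?thesis unfolding comes_from_def by blast
  qed
  then show ?thesis
    using f comp' null' unfolding null_functions_def by blast
qed

text \<open>The set \<open>(\<A>)\<^sub>\<epsilon>\<close>. Boundedness is required explicitly because \<open>Sup\<close> on \<open>real\<close> is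
  unspecified for unbounded sets.\<close>

definition thickening ::
  "('a \<Rightarrow> 'a) set \<Rightarrow> (('a \<Rightarrow> 'a) \<Rightarrow> real) set \<Rightarrow> real \<Rightarrow> (('a \<Rightarrow> 'a) \<Rightarrow> real) set" where
  "thickening G \<A> \<epsilon> =
     {f. \<exists>k\<in>\<A>. bdd_above ((\<lambda>g. \<bar>f g - k g\<bar>) ` G) \<and> (SUP g\<in>G. \<bar>f g - k g\<bar>) < \<epsilon>}"


section \<open>Colourings\<close>

text \<open>A colouring of the embeddings of \<open>A\<close> into \<open>F\<close> is a total function of which only the values on
  \<open>embeddings ar A F\<close> matter.\<close>

definition finite_colouring ::
  "('r \<Rightarrow> nat) \<Rightarrow> ('r, 'b) rel_structure \<Rightarrow> ('r, 'a) rel_structure \<Rightarrow> (('b \<Rightarrow> 'a) \<Rightarrow> real) \<Rightarrow> bool" where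
  "finite_colouring ar A F c \<longleftrightarrow> finite (c ` embeddings ar A F)"

definition colouring_on_group ::
  "('r, 'b) rel_structure \<Rightarrow> ('b \<Rightarrow> 'a) \<Rightarrow> (('b \<Rightarrow> 'a) \<Rightarrow> real) \<Rightarrow> ('a \<Rightarrow> 'a) \<Rightarrow> real" where
  "colouring_on_group A a0 c = (\<lambda>g. c (compose (carr A) g a0))"

end

theory Submission
  imports Defs "HOL-Library.Ramsey"
begin

text \<open>
  If no copy of \<open>B\<close> in \<open>F\<close> works, each copy carries a colouring of \<open>C\<close> and two embeddings
  \<open>a\<close>, \<open>a'\<close> of \<open>A\<close> into \<open>B\<close> whose colours \<open>v\<close>, \<open>v'\<close> are more than \<open>2 * \<epsilon>\<close> apart. There are
  finitely many such data, so by the free joint embedding property and pigeonhole one datum is shared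
  by all copies in free unions of arbitrarily many copies of \<open>B\<close>. Ultrahomogeneity turns these
  into arbitrarily large independence sets for the two closed sets where the extension of the
  approximating null function is close to \<open>v\<close> and to \<open>v'\<close>. Finite Ramsey and compactness produce
  an IN-pair in their product, on which that extension takes different values, contradicting nullness.
\<close>

section \<open>A pattern Ramsey theorem\<close>

text \<open>The fibre sizes add up to \<open>card A\<close>, so they cannot all stay within quotas
  of smaller total. The quota may vary with \<open>d\<close> because in the final theorem each datum
  brings its own threshold.\<close>

lemma pigeonhole_sum:
  fixes f :: "'a \<Rightarrow> 'd" and N :: "'d \<Rightarrow> nat"
  assumes "finite A" "finite D" "f ` A \<subseteq> D" "(\<Sum>d\<in>D. N d) < card A"
  shows "\<exists>d\<in>D. N d < card {a\<in>A. f a = d}"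
proof (rule ccontr)
  assume "\<not> ?thesis"
  then have "(\<Sum>d\<in>D. card {a\<in>A. f a = d}) \<le> (\<Sum>d\<in>D. N d)"
    by (intro sum_mono) (simp add: not_less)
  moreover have "(\<Sum>d\<in>D. card {a\<in>A. f a = d}) = card A"
    using sum.group[OF assms(1,2,3), of "\<lambda>_. 1::nat"] by simp
  ultimately show False using assms(4) by simp
qed

text \<open>Numbering the colours by a bijection reduces this to \<open>ramsey_full\<close>. The
  common colour \<open>d\<close> is left unrestricted, since \<open>H\<close> has no
  \<open>r\<close>-subsets when \<open>k < r\<close>.\<close>

lemma Ramsey_finite_colours:
  assumes "finite D"
  shows "\<exists>m. \<forall>f. (\<forall>I\<in>nsets {..<m::nat} r. f I \<in> D) \<longrightarrow>
           (\<exists>d. \<exists>H\<in>nsets {..<m} k. \<forall>I\<in>nsets H r. f I = d)"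
proof -
  obtain b where b: "bij_betw b D {..<card D}"
    using ex_bij_betw_finite_nat[OF assms] by (auto simp: lessThan_atLeast0)
  obtain m :: nat where m: "partn_lst {..<m} (replicate (card D) k) r"
    using ramsey_full by blast
  have "\<exists>d. \<exists>H\<in>nsets {..<m} k. \<forall>I\<in>nsets H r. f I = d"
    if f: "\<forall>I\<in>nsets {..<m} r. f I \<in> D" for f
  proof -
    have "(\<lambda>I. b (f I)) \<in> nsets {..<m} r \<rightarrow> {..<card D}"
      using f b by (auto simp: bij_betw_def)
    then obtain i H where "i < card D" and H: "H \<in> nsets {..<m} k"
      and hom: "(\<lambda>I. b (f I)) ` nsets H r \<subseteq> {i}"
      using m unfolding partn_lst_def monochromatic_def by force
    have "f I = inv_into D b i" if "I \<in> nsets H r" for I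
    proof -
      have "I \<in> nsets {..<m} r"
        using that H by (auto simp: nsets_def)
      then show ?thesis
        using f hom that b by (auto simp: bij_betw_def)
    qed
    then show ?thesis using H by blast
  qed
  then show ?thesis by blast
qed

text \<open>Give alternating bits to the members of a set: its position then decides the bit of an
  element, and homogeneity lets its colour depend on the position alone. Leaving out one outer
  element of a triple moves the middle one between an even and an odd position, so all patterns
  occur on middle elements. Pigeonhole removes the remaining dependence on the triple.\<close>

lemma pattern_Ramsey:
  fixes D :: "'d set"
  assumes D: "finite D"
  shows "\<exists>m::nat. \<forall>p. (\<forall>i<m. \<forall>\<sigma>\<subseteq>{..<m}. p i \<sigma> \<in> D) \<longrightarrow>
           (\<exists>c0 c1 s T. inj_on s {..<n::nat} \<and> (\<forall>i<n. s i < m) \<and>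
              (\<forall>\<rho>\<subseteq>{..<n}. T \<rho> \<subseteq> {..<m} \<and>
                 (\<forall>i<n. (s i \<in> T \<rho> \<longleftrightarrow> i \<in> \<rho>) \<and> p (s i) (T \<rho>) = (if i \<in> \<rho> then c1 else c0))))"
proof -
  \<comment> \<open>The number of triples, chosen so that more than \<open>n\<close> of them share
    one pair of colours.\<close>
  define q where "q = n * card (D \<times> D) + 1"
  define L where "L = {xs. set xs \<subseteq> D \<and> length xs = 2 * q}"
  have finL: "finite L"
    unfolding L_def using finite_lists_length_eq[OF D] by simp
  obtain m :: nat where m: "\<forall>f. (\<forall>I\<in>nsets {..<m} (2 * q). f I \<in> L) \<longrightarrow>
           (\<exists>d. \<exists>H\<in>nsets {..<m} (3 * q). \<forall>I\<in>nsets H (2 * q). f I = d)"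
    using Ramsey_finite_colours[OF finL, of "2 * q" "3 * q"] by (rule exE)
  \<comment> \<open>Positions count from 0; the members at odd positions are those with bit
    1.\<close>
  define \<tau> where "\<tau> I = (\<lambda>u. sorted_list_of_set I ! (2 * u + 1)) ` {..<q}" for I :: "nat set"
  have "\<exists>c0 c1 s T. inj_on s {..<n} \<and> (\<forall>i<n. s i < m) \<and>
              (\<forall>\<rho>\<subseteq>{..<n}. T \<rho> \<subseteq> {..<m} \<and>
                 (\<forall>i<n. (s i \<in> T \<rho> \<longleftrightarrow> i \<in> \<rho>) \<and> p (s i) (T \<rho>) = (if i \<in> \<rho> then c1 else c0)))"
    if p: "\<forall>i<m. \<forall>\<sigma>\<subseteq>{..<m}. p i \<sigma> \<in> D" for p
  proof -
    \<comment> \<open>The colour of a set lists the colours of its members, in increasing order,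
      under its own alternating pattern.\<close>
    define f where "f I = map (\<lambda>k. p (sorted_list_of_set I ! k) (\<tau> I)) [0..<2 * q]" for I
    have nth_in: "sorted_list_of_set I ! k \<in> I" if "finite I" "k < card I" for I :: "nat set" and k
      using that by (metis nth_mem sorted_list_of_set.length_sorted_key_list_of_set
          sorted_list_of_set.set_sorted_key_list_of_set)
    have \<tau>_sub: "\<tau> I \<subseteq> I" if "finite I" "card I = 2 * q" for I
      using that nth_in[OF that(1)] by (auto simp: \<tau>_def)
    have "\<forall>I\<in>nsets {..<m} (2 * q). f I \<in> L"
    proof
      fix I assume I: "I \<in> nsets {..<m} (2 * q)"
      then have "p (sorted_list_of_set I ! k) (\<tau> I) \<in> D" if "k < 2 * q" for k
        using p nth_in[of I k] \<tau>_sub[of I] that by (auto simp: nsets_def subset_iff)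
      then show "f I \<in> L" by (auto simp: f_def L_def)
    qed
    then obtain d H where H: "H \<in> nsets {..<m} (3 * q)"
      and hom: "\<And>I. I \<in> nsets H (2 * q) \<Longrightarrow> f I = d"
      using m[rule_format, of f] by blast
    define g where "g = (!) (sorted_list_of_set H)"
    have finH: "finite H" and cardH: "card H = 3 * q" and Hm: "H \<subseteq> {..<m}"
      using H by (auto simp: nsets_def)
    have g_less: "g i < g j" if "i < j" "j < 3 * q" for i j
      unfolding g_def using that cardH finH
      by (intro sorted_wrt_nth_less[OF strict_sorted_list_of_set]) simp_all
    have g_in: "g i \<in> H" if "i < 3 * q" for i
      unfolding g_def using nth_in finH cardH that by simp
    have g_inj: "g i = g j \<longleftrightarrow> i = j" if "i < 3 * q" "j < 3 * q" for i j
      using g_less that by (metis less_irrefl linorder_neqE_nat)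
    txt \<open>Of each triple \<open>3u, 3u+1, 3u+2\<close> the set \<open>I P\<close> keeps two elements including the middle one,
      which thereby gets position \<open>2u+1\<close> if \<open>u \<in> P\<close> and \<open>2u\<close> otherwise.\<close>
    define \<theta> where "\<theta> P k = 3 * (k div 2) + k mod 2 + (if k div 2 \<in> P then 0 else 1::nat)"
      for P :: "nat set" and k :: nat
    define I where "I P = (\<lambda>k. g (\<theta> P k)) ` {..<2 * q}" for P
    have \<theta>_lt: "\<theta> P k < 3 * q" if "k < 2 * q" for P k
    proof -
      have "k div 2 < q" "k mod 2 < 2" using that by auto
      then show ?thesis unfolding \<theta>_def by (cases "k mod 2 = 0") auto
    qed
    have \<theta>_less: "\<theta> P k < \<theta> P l" if "k < l" for P k l
    proof (cases "k div 2 = l div 2")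
      case True
      then have "k mod 2 < l mod 2" using that by (metis div_mult_mod_eq nat_add_left_cancel_less)
      then show ?thesis using True by (simp add: \<theta>_def)
    next
      case False
      then have "k div 2 < l div 2" using that by (simp add: div_le_mono le_neq_implies_less)
      moreover have "k mod 2 < 2" by simp
      ultimately show ?thesis unfolding \<theta>_def by auto
    qed
    have sortI: "sorted_list_of_set (I P) = map (\<lambda>k. g (\<theta> P k)) [0..<2 * q]" for P
    proof (rule strict_sorted_equal)
      show "sorted_wrt (<) (map (\<lambda>k. g (\<theta> P k)) [0..<2 * q])"
        by (auto simp: sorted_wrt_iff_nth_less intro!: g_less \<theta>_less \<theta>_lt)
    qed (auto simp: I_def)
    have I_in: "I P \<in> nsets H (2 * q)" for P
    proof -
      have "card (I P) = length (sorted_list_of_set (I P))" by simp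
      then show ?thesis
        using g_in \<theta>_lt by (auto simp: sortI nsets_def) (auto simp: I_def)
    qed
    have \<tau>I: "\<tau> (I P) = (\<lambda>u. g (\<theta> P (2 * u + 1))) ` {..<q}" for P
      unfolding \<tau>_def sortI by (intro image_cong) auto
    have colour: "p (g (\<theta> P k)) (\<tau> (I P)) = d ! k" if "k < 2 * q" for P k
      using hom[OF I_in, of P, symmetric] that by (simp add: f_def sortI)
    \<comment> \<open>\<open>Ramsey_finite_colours\<close> does not place the entries of
      \<open>d\<close> in \<open>D\<close>; they are read off the actual colours of the homogeneous
      subset \<open>I {}\<close>.\<close>
    have d_in: "d ! k \<in> D" if "k < 2 * q" for k
    proof -
      have "I {} \<subseteq> {..<m}" "finite (I {})" "card (I {}) = 2 * q"
        using I_in[of "{}"] Hm by (auto simp: nsets_def)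
      then show ?thesis
        using colour[OF that, of "{}", symmetric] p \<tau>_sub[of "I {}"] g_in[OF \<theta>_lt[OF that]] Hm
        by (auto simp: subset_iff)
    qed
    have "(\<lambda>u. (d ! (2 * u), d ! (2 * u + 1))) ` {..<q} \<subseteq> D \<times> D"
      using d_in by auto
    moreover have "(\<Sum>_\<in>D \<times> D. n) < card {..<q}"
      by (simp add: q_def mult.commute)
    ultimately obtain c where c: "n < card {u\<in>{..<q}. (d ! (2 * u), d ! (2 * u + 1)) = c}"
      using pigeonhole_sum[OF finite_lessThan finite_cartesian_product[OF D D]] by blast
    then obtain e where e: "inj_on e {..<n}"
      "e ` {..<n} \<subseteq> {u\<in>{..<q}. (d ! (2 * u), d ! (2 * u + 1)) = c}"
      using card_le_inj[of "{..<n}" "{u\<in>{..<q}. (d ! (2 * u), d ! (2 * u + 1)) = c}"] by auto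
    have e_lt: "e i < q" and e_col: "d ! (2 * e i) = fst c" "d ! (2 * e i + 1) = snd c"
      if "i < n" for i
      using e(2) that by auto
    \<comment> \<open>The middle element of triple \<open>e i\<close> lies in every
      \<open>I P\<close>, and only the parity of its position there depends on
      \<open>P\<close>.\<close>
    define s where "s i = g (3 * e i + 1)" for i
    define T where "T \<rho> = \<tau> (I (e ` \<rho>))" for \<rho>
    have s_inj: "inj_on s {..<n}"
    proof (rule inj_onI)
      fix i j assume ij: "i \<in> {..<n}" "j \<in> {..<n}" "s i = s j"
      then have "3 * e i + 1 = 3 * e j + 1"
        using g_inj[of "3 * e i + 1" "3 * e j + 1"] e_lt[of i] e_lt[of j] by (auto simp: s_def)
      then show "i = j" using ij e(1) by (auto dest: inj_onD)
    qed
    have s_m: "s i < m" if "i < n" for i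
      using g_in[of "3 * e i + 1"] e_lt[OF that] Hm by (auto simp: s_def)
    have T_m: "T \<rho> \<subseteq> {..<m}" for \<rho>
      using \<tau>_sub[of "I (e ` \<rho>)"] I_in[of "e ` \<rho>"] Hm unfolding T_def by (auto simp: nsets_def)
    have mem_e: "e i \<in> e ` \<rho> \<longleftrightarrow> i \<in> \<rho>" if "i < n" "\<rho> \<subseteq> {..<n}" for i \<rho>
      using that e(1) by (auto dest: inj_onD)
    have s_T: "s i \<in> T \<rho> \<longleftrightarrow> i \<in> \<rho>" if i: "i < n" and \<rho>: "\<rho> \<subseteq> {..<n}" for i \<rho>
    proof -
      have "s i \<in> T \<rho> \<longleftrightarrow> (\<exists>u<q. g (3 * e i + 1) = g (\<theta> (e ` \<rho>) (2 * u + 1)))"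
        unfolding s_def T_def \<tau>I by auto
      also have "\<dots> \<longleftrightarrow> (\<exists>u<q. 3 * e i + 1 = \<theta> (e ` \<rho>) (2 * u + 1))"
        using e_lt[OF i] by (intro ex_cong1 conj_cong refl g_inj \<theta>_lt) auto
      \<comment> \<open>At \<open>2 * u + 1\<close> the map \<theta> takes the value
        \<open>3 * u + 1\<close> if \<open>u\<close> comes from \<rho> and \<open>3 * u + 2\<close>
        otherwise; residues modulo 3 exclude the second case.\<close>
      also have "\<dots> \<longleftrightarrow> (\<exists>u<q. u = e i \<and> u \<in> e ` \<rho>)"
        by (intro ex_cong1 conj_cong refl) (auto simp: \<theta>_def, presburger+)
      also have "\<dots> \<longleftrightarrow> i \<in> \<rho>"
        using e_lt[OF i] mem_e[OF i \<rho>] by auto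
      finally show ?thesis .
    qed
    have s_col: "p (s i) (T \<rho>) = (if i \<in> \<rho> then snd c else fst c)"
      if i: "i < n" and \<rho>: "\<rho> \<subseteq> {..<n}" for i \<rho>
    proof -
      \<comment> \<open>The position of the middle element of triple \<open>e i\<close> in the
        chosen set: odd exactly when its bit is 1.\<close>
      define k where "k = 2 * e i + (if i \<in> \<rho> then 1 else 0)"
      have "k < 2 * q" using e_lt[OF i] by (auto simp: k_def)
      moreover have "\<theta> (e ` \<rho>) k = 3 * e i + 1"
        using mem_e[OF i \<rho>] by (auto simp: \<theta>_def k_def)
      ultimately have "p (s i) (T \<rho>) = d ! k"
        using colour[of k "e ` \<rho>"] by (simp add: s_def T_def)
      then show ?thesis using e_col[OF i] by (simp add: k_def)
    qed
    show ?thesis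
      by (rule exI[of _ "fst c"], rule exI[of _ "snd c"], rule exI[of _ s], rule exI[of _ T])
        (intro conjI allI impI s_inj s_m T_m s_T s_col)
  qed
  then show ?thesis by (intro exI[of _ m] allI impI)
qed


section \<open>Unbounded independence and IN-pairs\<close>

lemma G_flow_act_in:
  assumes "G_flow G Y act" "g \<in> G" "y \<in> topspace Y"
  shows "act g y \<in> topspace Y"
proof -
  have "continuous_map (prod_topology (pointwise_topology G) Y) Y (\<lambda>(g, y). act g y)"
    using assms(1) unfolding G_flow_def by blast
  moreover have "(g, y) \<in> topspace (prod_topology (pointwise_topology G) Y)"
    using assms(2,3) by (simp add: pointwise_topology_def)
  ultimately have "(\<lambda>(g, y). act g y) (g, y) \<in> topspace Y"
    using continuous_map_image_subset_topspace by blast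
  then show ?thesis by simp
qed

text \<open>The actions of \<open>g\<close> and \<open>inv g\<close> are mutually inverse on the
  space. This replaces the translated sets in \<open>independence_set\<close> by conditions on the
  moved point.\<close>

lemma mem_act_inv_image_iff:
  assumes flow: "G_flow G Y act" and G: "\<And>g. g \<in> G \<Longrightarrow> bij g \<and> inv g \<in> G"
    and g: "g \<in> G" and y: "y \<in> topspace Y" and S: "S \<subseteq> topspace Y"
  shows "y \<in> act (inv g) ` S \<longleftrightarrow> act g y \<in> S"
proof -
  have comp: "act (h \<circ> k) z = act h (act k z)" if "h \<in> G" "k \<in> G" "z \<in> topspace Y" for h k z
    using flow that unfolding G_flow_def by blast
  have one: "act id z = z" if "z \<in> topspace Y" for z
    using flow that unfolding G_flow_def by blast
  have "bij g" and inv: "inv g \<in> G"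
    using G[OF g] by auto
  have "g \<circ> inv g = id"
    using \<open>bij g\<close> bij_is_surj surj_iff by metis
  moreover have "inv g \<circ> g = id"
    using \<open>bij g\<close> bij_is_inj inv_o_cancel by metis
  ultimately have 1: "act g (act (inv g) z) = z" and 2: "act (inv g) (act g z) = z"
    if "z \<in> topspace Y" for z
    using comp[OF g inv that] comp[OF inv g that] one[OF that] by simp_all
  show ?thesis
  proof
    assume "y \<in> act (inv g) ` S"
    then obtain z where "z \<in> S" "y = act (inv g) z" by blast
    then show "act g y \<in> S" using 1 S by auto
  next
    assume "act g y \<in> S"
    then show "y \<in> act (inv g) ` S" using 2[OF y] by (metis imageI)
  qed
qed

text \<open>A choice function on group elements pulls back along \<open>j\<close> to a subset of the
  indices, whether or not \<open>j\<close> is injective. Only the size of the independence set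
  depends on injectivity.\<close>

lemma independence_setI:
  assumes flow: "G_flow G Y act" and G: "\<And>g. g \<in> G \<Longrightarrow> bij g \<and> inv g \<in> G"
    and sub: "A0 \<subseteq> topspace Y" "A1 \<subseteq> topspace Y"
    and j: "\<And>i. i < n \<Longrightarrow> j i \<in> G"
    and y: "\<And>\<rho>. \<rho> \<subseteq> {..<n::nat} \<Longrightarrow>
              \<exists>y\<in>topspace Y. \<forall>i<n. act (j i) y \<in> (if i \<in> \<rho> then A1 else A0)"
  shows "independence_set G act A0 A1 (j ` {..<n})"
  unfolding independence_set_def
proof (intro conjI allI impI)
  show "j ` {..<n} \<subseteq> G" using j by auto
next
  fix J and \<sigma> :: "('a \<Rightarrow> 'a) \<Rightarrow> bool"
  assume J: "finite J \<and> J \<subseteq> j ` {..<n}"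
  obtain y where y: "y \<in> topspace Y"
    "\<forall>i<n. act (j i) y \<in> (if i \<in> {i. i < n \<and> \<sigma> (j i)} then A1 else A0)"
    using y[of "{i. i < n \<and> \<sigma> (j i)}"] by auto
  have "y \<in> act (inv k) ` (if \<sigma> k then A1 else A0)" if k: "k \<in> J" for k
  proof -
    obtain i where i: "i < n" "k = j i" using k J by blast
    have "act k y \<in> (if \<sigma> k then A1 else A0)"
      using y(2)[rule_format, OF i(1)] i by simp
    moreover have "(if \<sigma> k then A1 else A0) \<subseteq> topspace Y" using sub by auto
    ultimately show ?thesis
      using mem_act_inv_image_iff[OF flow G _ y(1)] j[OF i(1)] i(2) by blast
  qed
  then show "(\<Inter>k\<in>J. act (inv k) ` (if \<sigma> k then A1 else A0)) \<noteq> {}" by blast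
qed

text \<open>As \<open>I\<close> is finite, it may itself serve as the finite subset
  \<open>J\<close>. Membership in the space stays under the quantifier over \<open>I\<close>: for
  empty \<open>I\<close> the intersection is the whole type and says nothing about
  \<open>y\<close>.\<close>

lemma independence_setD:
  assumes flow: "G_flow G Y act" and G: "\<And>g. g \<in> G \<Longrightarrow> bij g \<and> inv g \<in> G"
    and sub: "A0 \<subseteq> topspace Y" "A1 \<subseteq> topspace Y"
    and I: "independence_set G act A0 A1 I" "finite I"
  shows "\<exists>y. \<forall>j\<in>I. y \<in> topspace Y \<and> act j y \<in> (if \<sigma> j then A1 else A0)"
proof -
  obtain y where y: "y \<in> (\<Inter>j\<in>I. act (inv j) ` (if \<sigma> j then A1 else A0))"
    using I unfolding independence_set_def by blast
  have "y \<in> topspace Y \<and> act j y \<in> (if \<sigma> j then A1 else A0)" if j: "j \<in> I" for j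
  proof -
    have jG: "j \<in> G" using I j unfolding independence_set_def by blast
    have S: "(if \<sigma> j then A1 else A0) \<subseteq> topspace Y" using sub by auto
    have mem: "y \<in> act (inv j) ` (if \<sigma> j then A1 else A0)" using y j by blast
    then obtain z where z: "z \<in> (if \<sigma> j then A1 else A0)" "y = act (inv j) z" by blast
    have yY: "y \<in> topspace Y"
      unfolding z(2) using z(1) S G[OF jG] by (intro G_flow_act_in[OF flow]) blast+
    show ?thesis
      using mem_act_inv_image_iff[OF flow G jG yY S] mem yY by blast
  qed
  then show ?thesis by blast
qed

text \<open>If there were no such pair, compactness would cover \<open>K0 \<times> K1\<close> by
  finitely many open boxes, each with a bound on its independence sets.
  \<open>pattern_Ramsey\<close> extracts from a large independence set for \<open>K0\<close>,
  \<open>K1\<close> one for the two sides of a single box, of size beyond its bound.\<close>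

lemma IN_pair_if_independence_unbounded:
  fixes Y :: "'y topology"
  assumes flow: "G_flow G Y act" and G: "\<And>g. g \<in> G \<Longrightarrow> bij g \<and> inv g \<in> G"
    and K: "closedin Y K0" "closedin Y K1"
    and unbounded: "\<And>n. \<exists>I. independence_set G act K0 K1 I \<and> finite I \<and> card I = n"
  shows "\<exists>x\<in>K0. \<exists>y\<in>K1. IN_pair G Y act x y"
proof (rule ccontr)
  assume none: "\<not> ?thesis"
  have sub: "K0 \<subseteq> topspace Y" "K1 \<subseteq> topspace Y"
    using K closedin_subset by auto
  define Q where "Q = {uv. openin Y (fst uv) \<and> openin Y (snd uv) \<and>
      (\<exists>n. \<forall>I. independence_set G act (fst uv) (snd uv) I \<longrightarrow> finite I \<and> card I < n)}"
  have "compactin (prod_topology Y Y) (K0 \<times> K1)"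
    using flow K unfolding compactin_Times G_flow_def by (auto intro: closedin_compact_space)
  moreover have "\<forall>W\<in>(\<lambda>uv. fst uv \<times> snd uv) ` Q. openin (prod_topology Y Y) W"
    by (auto simp: Q_def openin_prod_Times_iff)
  moreover have "K0 \<times> K1 \<subseteq> \<Union> ((\<lambda>uv. fst uv \<times> snd uv) ` Q)"
  proof (rule subsetI)
    fix xy assume xy: "xy \<in> K0 \<times> K1"
    then have "\<not> IN_pair G Y act (fst xy) (snd xy)"
      using none by auto
    moreover have "fst xy \<in> topspace Y" "snd xy \<in> topspace Y"
      using xy sub by auto
    ultimately obtain U0 U1 n where U: "openin Y U0" "fst xy \<in> U0" "openin Y U1" "snd xy \<in> U1"
      "\<forall>I. independence_set G act U0 U1 I \<longrightarrow> \<not> (infinite I \<or> n \<le> card I)"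
      unfolding IN_pair_def by blast
    then have "(U0, U1) \<in> Q"
      unfolding Q_def by (auto simp: not_le)
    then show "xy \<in> \<Union> ((\<lambda>uv. fst uv \<times> snd uv) ` Q)"
      using U(2,4) by (intro UN_I[of "(U0, U1)"]) (auto simp: mem_Times_iff)
  qed
  ultimately obtain \<W> where "finite \<W>" "\<W> \<subseteq> (\<lambda>uv. fst uv \<times> snd uv) ` Q" "K0 \<times> K1 \<subseteq> \<Union>\<W>"
    unfolding compactin_def by meson
  then obtain P where P: "P \<subseteq> Q" "finite P" and cover: "K0 \<times> K1 \<subseteq> (\<Union>uv\<in>P. fst uv \<times> snd uv)"
    using finite_subset_image[of \<W> "\<lambda>uv. fst uv \<times> snd uv" Q] by auto
  have "\<forall>uv\<in>P. \<exists>n. \<forall>I. independence_set G act (fst uv) (snd uv) I \<longrightarrow> finite I \<and> card I < n"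
    using P(1) unfolding Q_def by blast
  then obtain b where b: "\<And>uv I. uv \<in> P \<Longrightarrow> independence_set G act (fst uv) (snd uv) I \<Longrightarrow> card I < b uv"
    by metis
  \<comment> \<open>Larger than the bound of every box in the finite cover, and positive.\<close>
  define n where "n = Suc (\<Sum>uv\<in>P. b uv)"
  obtain m :: nat where m: "\<forall>p. (\<forall>i<m. \<forall>\<sigma>\<subseteq>{..<m}. p i \<sigma> \<in> Pow P) \<longrightarrow>
           (\<exists>c0 c1 s T. inj_on s {..<n} \<and> (\<forall>i<n. s i < m) \<and>
              (\<forall>\<rho>\<subseteq>{..<n}. T \<rho> \<subseteq> {..<m} \<and>
                 (\<forall>i<n. (s i \<in> T \<rho> \<longleftrightarrow> i \<in> \<rho>) \<and> p (s i) (T \<rho>) = (if i \<in> \<rho> then c1 else c0))))"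
    using pattern_Ramsey[of "Pow P" n, OF finite_Pow_iff[THEN iffD2, OF P(2)]] by (rule exE)
  obtain I where I: "independence_set G act K0 K1 I" "finite I" "card I = m"
    using unbounded by blast
  obtain j where j: "bij_betw j {..<m} I"
    using ex_bij_betw_nat_finite[OF I(2)] I(3) by (auto simp: lessThan_atLeast0)
  have jI: "j i \<in> I" if "i < m" for i
    using j that by (auto simp: bij_betw_def)
  have jG: "j i \<in> G" if "i < m" for i
    using jI[OF that] I(1) unfolding independence_set_def by blast
  have "\<exists>y. \<forall>i<m. y \<in> topspace Y \<and> act (j i) y \<in> (if i \<in> \<sigma> then K1 else K0)" for \<sigma>
  proof -
    obtain y where y: "\<forall>k\<in>I. y \<in> topspace Y \<and>
        act k y \<in> (if inv_into {..<m} j k \<in> \<sigma> then K1 else K0)"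
      using independence_setD[OF flow G sub I(1,2), of "\<lambda>k. inv_into {..<m} j k \<in> \<sigma>"] by blast
    have "inv_into {..<m} j (j i) = i" if "i < m" for i
      using j that by (simp add: bij_betw_def)
    then have "\<forall>i<m. y \<in> topspace Y \<and> act (j i) y \<in> (if i \<in> \<sigma> then K1 else K0)"
      using y jI by metis
    then show ?thesis by blast
  qed
  then obtain y where y: "\<And>\<sigma> i. i < m \<Longrightarrow>
      y \<sigma> \<in> topspace Y \<and> act (j i) (y \<sigma>) \<in> (if i \<in> \<sigma> then K1 else K0)"
    by metis
  \<comment> \<open>The colour is the set of all boxes whose side selected by the bit of
    \<open>i\<close> contains the moved point. Recording all of them postpones the choice of a box
    until both bits are known.\<close>
  define p where "p i \<sigma> = {uv\<in>P. act (j i) (y \<sigma>) \<in> (if i \<in> \<sigma> then snd uv else fst uv)}" for i \<sigma>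
  have "\<forall>i<m. \<forall>\<sigma>\<subseteq>{..<m}. p i \<sigma> \<in> Pow P"
    by (auto simp: p_def)
  then have "\<exists>c0 c1 s T. inj_on s {..<n} \<and> (\<forall>i<n. s i < m) \<and>
              (\<forall>\<rho>\<subseteq>{..<n}. T \<rho> \<subseteq> {..<m} \<and>
                 (\<forall>i<n. (s i \<in> T \<rho> \<longleftrightarrow> i \<in> \<rho>) \<and> p (s i) (T \<rho>) = (if i \<in> \<rho> then c1 else c0)))"
    by (rule mp[OF spec[OF m, of p]])
  then obtain c0 c1 s T where inj: "inj_on s {..<n}" and s_lt: "\<forall>i<n. s i < m"
    and pat: "\<forall>\<rho>\<subseteq>{..<n}. T \<rho> \<subseteq> {..<m} \<and>
      (\<forall>i<n. (s i \<in> T \<rho> \<longleftrightarrow> i \<in> \<rho>) \<and> p (s i) (T \<rho>) = (if i \<in> \<rho> then c1 else c0))"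
    by (elim exE conjE)
  have s: "s i < m" if "i < n" for i
    using s_lt that by blast
  have T: "s i \<in> T \<rho> \<longleftrightarrow> i \<in> \<rho>" and col: "p (s i) (T \<rho>) = (if i \<in> \<rho> then c1 else c0)"
    if "\<rho> \<subseteq> {..<n}" "i < n" for \<rho> i
    using pat[rule_format, OF that(1)] that(2) by simp_all
  have n0: "0 < n" by (simp add: n_def)
  \<comment> \<open>One coordinate under both bits gives a point of \<open>K0\<close> and a point of
    \<open>K1\<close>. A box covering this pair belongs to \<open>c0\<close> and to
    \<open>c1\<close>, hence serves all coordinates and all patterns.\<close>
  let ?x0 = "act (j (s 0)) (y (T {}))" and ?x1 = "act (j (s 0)) (y (T {0}))"
  have nT: "s 0 \<notin> T {}" "s 0 \<in> T {0}"
    using T[of "{}" 0] T[of "{0}" 0] n0 by auto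
  have "?x0 \<in> K0" "?x1 \<in> K1"
    using y[OF s[OF n0], of "T {}"] y[OF s[OF n0], of "T {0}"] nT by auto
  then obtain uv where uv: "uv \<in> P" "?x0 \<in> fst uv" "?x1 \<in> snd uv"
    using cover by blast
  have "c0 = p (s 0) (T {})" "c1 = p (s 0) (T {0})"
    using col[of "{}" 0] col[of "{0}" 0] n0 by auto
  then have uvc: "uv \<in> c0" "uv \<in> c1"
    using uv nT by (simp_all add: p_def)
  have "independence_set G act (fst uv) (snd uv) ((j \<circ> s) ` {..<n})"
  proof (rule independence_setI[OF flow G])
    show "fst uv \<subseteq> topspace Y" "snd uv \<subseteq> topspace Y"
      using uv(1) P(1) unfolding Q_def by (blast dest: openin_subset)+
    show "(j \<circ> s) i \<in> G" if "i < n" for i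
      using jG s that by simp
  next
    fix \<rho> assume \<rho>: "\<rho> \<subseteq> {..<n}"
    have "act ((j \<circ> s) i) (y (T \<rho>)) \<in> (if i \<in> \<rho> then snd uv else fst uv)" if i: "i < n" for i
    proof -
      have "uv \<in> p (s i) (T \<rho>)" using col[OF \<rho> i] uvc by simp
      then show ?thesis using T[OF \<rho> i] by (simp add: p_def)
    qed
    then show "\<exists>y\<in>topspace Y. \<forall>i<n. act ((j \<circ> s) i) y \<in> (if i \<in> \<rho> then snd uv else fst uv)"
      using y[OF s[OF n0]] by blast
  qed
  then have "card ((j \<circ> s) ` {..<n}) < b uv" using b uv(1) by blast
  moreover have "card ((j \<circ> s) ` {..<n}) = n"
  proof -
    have "inj_on j (s ` {..<n})"
      using j s by (auto simp: bij_betw_def intro: inj_on_subset)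
    then have "inj_on (j \<circ> s) {..<n}"
      using inj by (intro comp_inj_on)
    then show ?thesis using card_image by fastforce
  qed
  moreover have "b uv \<le> (\<Sum>uv\<in>P. b uv)"
    using uv(1) P(2) by (intro member_le_sum) auto
  ultimately show False by (simp add: n_def)
qed


section \<open>Free unions of copies\<close>

lemma embeddings_interp:
  assumes "f \<in> embeddings ar M N" "length xs = ar r" "set xs \<subseteq> carr M"
  shows "interp N r (map f xs) \<longleftrightarrow> interp M r xs"
  using assms unfolding embeddings_def preserves_rels_def by blast

lemma embeddings_compose:
  assumes f: "f \<in> embeddings ar M N" and g: "g \<in> embeddings ar N P"
  shows "compose (carr M) g f \<in> embeddings ar M P"
proof -
  have fN: "f ` carr M \<subseteq> carr N"
    using f by (auto simp: embeddings_def)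
  have "interp M r xs \<longleftrightarrow> interp P r (map (compose (carr M) g f) xs)"
    if "length xs = ar r" "set xs \<subseteq> carr M" for r xs
  proof -
    have "map (compose (carr M) g f) xs = map g (map f xs)"
      using that(2) by (auto simp: compose_def)
    moreover have "set (map f xs) \<subseteq> carr N"
      using that(2) fN by auto
    ultimately show ?thesis
      using embeddings_interp[OF f that] embeddings_interp[OF g, of "map f xs" r] that(1)
      by (simp del: map_map)
  qed
  moreover have "inj_on (compose (carr M) g f) (carr M)"
  proof -
    have "inj_on (g \<circ> f) (carr M)"
      using f g fN by (intro comp_inj_on) (auto simp: embeddings_def intro: inj_on_subset)
    then show ?thesis
      by (simp add: compose_def comp_def inj_on_restrict_eq)
  qed
  moreover have "compose (carr M) g f \<in> carr M \<rightarrow>\<^sub>E carr P"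
    using f g fN by (auto simp: embeddings_def compose_def)
  ultimately show ?thesis
    by (simp add: embeddings_def preserves_rels_def)
qed

lemma restrict_id_in_embeddings: "restrict id (carr M) \<in> embeddings ar M M"
proof -
  have "map (restrict id (carr M)) xs = xs" if "set xs \<subseteq> carr M" for xs
    using that by (intro map_idI) auto
  then show ?thesis
    by (auto simp: embeddings_def preserves_rels_def inj_on_def)
qed

lemma in_Age_if_embeds:
  assumes "f \<in> embeddings ar M N" "in_Age ar F N" "finite (carr M)"
  shows "in_Age ar F M"
  using assms embeddings_compose unfolding in_Age_def by blast

text \<open>Following the inverse of \<open>e\<close> by \<open>e'\<close> gives an isomorphism
  between two finite substructures of \<open>F\<close>, to which the definition of ultrahomogeneity
  applies.\<close>

lemma ultrahomogeneous_extend: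
  assumes F: "ultrahomogeneous ar F" and fin: "finite (carr M)"
    and e: "e \<in> embeddings ar M F" and e': "e' \<in> embeddings ar M F"
  shows "\<exists>g\<in>Aut ar F. \<forall>x\<in>carr M. g (e x) = e' x"
proof -
  define d where "d = inv_into (carr M) e"
  define f where "f = restrict (e' \<circ> d) (e ` carr M)"
  have inj: "inj_on e (carr M)" "inj_on e' (carr M)"
    using e e' by (auto simp: embeddings_def)
  have de: "d (e x) = x" if "x \<in> carr M" for x
    using inj(1) that by (simp add: d_def)
  have fe: "f (e x) = e' x" if "x \<in> carr M" for x
    using that de by (simp add: f_def)
  have img: "f ` e ` carr M = e' ` carr M"
    unfolding image_image using fe by (rule image_cong[OF refl])
  have sub: "e ` carr M \<subseteq> carr F" "e' ` carr M \<subseteq> carr F"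
    using e e' by (auto simp: embeddings_def)
  have "inj_on f (e ` carr M)"
    using inj(2) fe by (auto simp: inj_on_def)
  moreover have "interp F r xs \<longleftrightarrow> interp F r (map f xs)"
    if len: "length xs = ar r" and xs: "set xs \<subseteq> e ` carr M" for r xs
  proof -
    have ys: "set (map d xs) \<subseteq> carr M" "length (map d xs) = ar r"
      using xs de len by auto
    have "map e (map d xs) = xs" "map e' (map d xs) = map f xs"
      using xs de fe by (auto intro!: map_idI)
    then show ?thesis
      using embeddings_interp[OF e ys(2,1)] embeddings_interp[OF e' ys(2,1)] by (simp del: map_map)
  qed
  moreover have "f \<in> e ` carr M \<rightarrow>\<^sub>E e' ` carr M"
    using fe by (auto simp: PiE_def f_def)
  ultimately have "f \<in> isomorphisms ar (substructure F (e ` carr M)) (substructure F (e' ` carr M))"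
    using img by (simp add: isomorphisms_def embeddings_def preserves_rels_def substructure_def)
  then have "\<exists>g\<in>Aut ar F. \<forall>x\<in>e ` carr M. g x = f x"
    using fin sub by (intro F[unfolded ultrahomogeneous_def, rule_format, of _ "e' ` carr M"]) simp
  then show ?thesis using fe by auto
qed

lemma Aut_inv:
  assumes g: "g \<in> Aut ar F"
  shows "inv g \<in> Aut ar F"
proof -
  have perm: "g permutes carr F" and rel: "preserves_rels ar F F g"
    using g by (auto simp: Aut_def)
  have "interp F r xs \<longleftrightarrow> interp F r (map (inv g) xs)"
    if "length xs = ar r" "set xs \<subseteq> carr F" for r xs
  proof -
    have "map g (map (inv g) xs) = xs"
      using permutes_inverses[OF perm] by (simp add: map_idI)
    moreover have "set (map (inv g) xs) \<subseteq> carr F"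
      using that(2) permutes_in_image[OF permutes_inv[OF perm]] by auto
    ultimately show ?thesis
      using rel[unfolded preserves_rels_def, rule_format, of "map (inv g) xs" r] that(1)
      by (simp del: map_map)
  qed
  then show ?thesis
    using permutes_inv[OF perm] by (simp add: Aut_def preserves_rels_def)
qed

lemma Aut_comp:
  assumes g: "g \<in> Aut ar F" and h: "h \<in> Aut ar F"
  shows "g \<circ> h \<in> Aut ar F"
proof -
  have "interp F r xs \<longleftrightarrow> interp F r (map (g \<circ> h) xs)"
    if "length xs = ar r" "set xs \<subseteq> carr F" for r xs
  proof -
    have "set (map h xs) \<subseteq> carr F"
      using that(2) h permutes_in_image[of h "carr F"] by (auto simp: Aut_def)
    moreover have g': "preserves_rels ar F F g" and h': "preserves_rels ar F F h"
      using g h by (simp_all add: Aut_def)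
    ultimately have "interp F r (map h xs) \<longleftrightarrow> interp F r (map g (map h xs))"
      using that(1) by (intro g'[unfolded preserves_rels_def, rule_format]) simp
    then show ?thesis
      using h'[unfolded preserves_rels_def, rule_format, of xs r] that by simp
  qed
  then show ?thesis
    using g h by (simp add: Aut_def preserves_rels_def permutes_compose)
qed

section \<open>Disjoint copies of a structure\<close>

text \<open>On the empty tuple (arity \<open>0\<close>) \<open>copies I M\<close> agrees with \<open>M\<close>, even when \<open>I\<close> is empty.\<close>

definition copies :: "'i set \<Rightarrow> ('r, 'b) rel_structure \<Rightarrow> ('r, 'i \<times> 'b) rel_structure" where
  "copies I M =
     \<lparr>carr = I \<times> carr M,
      interp = (\<lambda>r xs. (\<forall>p\<in>set xs. \<forall>q\<in>set xs. fst p = fst q) \<and> interp M r (map snd xs))\<rparr>"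

lemma carr_copies [simp]: "carr (copies I M) = I \<times> carr M"
  by (simp add: copies_def)

text \<open>No relation links different copies, so the embeddings \<open>a i\<close> need no
  compatibility with each other. This freedom of choosing copy by copy is the source of
  independence.\<close>

lemma copies_map_in_embeddings:
  assumes \<phi>: "inj_on \<phi> I" "\<phi> ` I \<subseteq> J" and a: "\<And>i. a i \<in> embeddings ar M N"
  shows "(\<lambda>p\<in>I \<times> carr M. (\<phi> (fst p), a (fst p) (snd p))) \<in> embeddings ar (copies I M) (copies J N)"
proof -
  define f where "f = (\<lambda>p\<in>I \<times> carr M. (\<phi> (fst p), a (fst p) (snd p)))"
  have f_apply: "f p = (\<phi> (fst p), a (fst p) (snd p))" "fst p \<in> I" "snd p \<in> carr M"
    if "p \<in> I \<times> carr M" for p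
    using that by (auto simp: f_def)
  have a_in: "a i x \<in> carr N" if "x \<in> carr M" for i x
    using a[of i] that by (auto simp: embeddings_def)
  have a_inj: "a i x = a i y \<longleftrightarrow> x = y" if "x \<in> carr M" "y \<in> carr M" for i x y
    using a[of i] that by (auto simp: embeddings_def inj_on_def)
  have \<phi>_inj: "\<phi> i = \<phi> k \<longleftrightarrow> i = k" if "i \<in> I" "k \<in> I" for i k
    using \<phi> that by (auto simp: inj_on_def)
  have "interp (copies I M) r xs \<longleftrightarrow> interp (copies J N) r (map f xs)"
    if len: "length xs = ar r" and xs: "set xs \<subseteq> I \<times> carr M" for r xs
  proof -
    have in_xs: "p \<in> I \<times> carr M" if "p \<in> set xs" for p
      using that xs by blast
    \<comment> \<open>Injectivity of \<phi> is what keeps tuples spread over several copies from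
      landing in one.\<close>
    have *: "(\<forall>p\<in>set (map f xs). \<forall>q\<in>set (map f xs). fst p = fst q) \<longleftrightarrow>
        (\<forall>p\<in>set xs. \<forall>q\<in>set xs. fst p = fst q)"
      using f_apply[OF in_xs] \<phi>_inj by simp
    have "interp M r (map snd xs) \<longleftrightarrow> interp N r (map snd (map f xs))"
      if eq: "\<forall>p\<in>set xs. \<forall>q\<in>set xs. fst p = fst q"
    proof -
      obtain i where i: "\<forall>p\<in>set xs. fst p = i"
        using eq by blast
      have "map snd (map f xs) = map (a i) (map snd xs)"
        using i f_apply(1)[OF in_xs] by simp
      moreover have "set (map snd xs) \<subseteq> carr M"
        using f_apply(3)[OF in_xs] by auto
      ultimately show ?thesis
        using embeddings_interp[OF a[of i], of "map snd xs" r] len by (simp del: map_map)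
    qed
    then show ?thesis
      unfolding copies_def rel_structure.simps using * by blast
  qed
  moreover have "inj_on f (I \<times> carr M)"
    using \<phi>_inj a_inj f_apply by (auto simp: inj_on_def)
  moreover have "f \<in> I \<times> carr M \<rightarrow>\<^sub>E J \<times> carr N"
    using a_in \<phi>(2) by (auto simp: PiE_def f_def)
  ultimately show ?thesis
    unfolding f_def[symmetric] by (simp add: embeddings_def preserves_rels_def)
qed

text \<open>Induction on the number of copies, each added by one free union.\<close>

lemma in_Age_copies:
  fixes I :: "'i set" and M :: "('r, 'b) rel_structure"
  assumes F: "free_JEP ar F" and M: "in_Age ar F M" and I: "finite I"
  shows "in_Age ar F (copies I M)"
  using I
proof (induction I rule: finite_induct)
  case empty
  obtain f where f: "f \<in> embeddings ar M F"
    using M unfolding in_Age_def by blast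
  \<comment> \<open>With no points left, only relations of arity 0 have to be compared.\<close>
  have "interp M r [] \<longleftrightarrow> interp F r []" if "ar r = 0" for r
    using that embeddings_interp[OF f, of "[]" r] by simp
  then have "(\<lambda>_. undefined) \<in> embeddings ar (copies {} M) F"
    by (auto simp: embeddings_def preserves_rels_def copies_def)
  then show ?case by (auto simp: in_Age_def)
next
  case (insert i I)
  define f where "f = (\<lambda>p\<in>insert i I \<times> carr M. if fst p = i then Inr (snd p) else Inl p)"
  have "interp (copies (insert i I) M) r xs \<longleftrightarrow> interp (free_union (copies I M) M) r (map f xs)"
    if "length xs = ar r" and xs: "set xs \<subseteq> insert i I \<times> carr M" for r xs
  proof -
    define f' where "f' = (\<lambda>p. if fst p = i then Inr (snd p) else Inl p :: ('i \<times> 'b) + 'b)"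
    have f_xs: "map f xs = map f' xs"
      using xs by (auto simp: f_def f'_def)
    have L: "map f' zs = map Inl ys \<longleftrightarrow> ys = zs \<and> (\<forall>p\<in>set zs. fst p \<noteq> i)" for zs ys
      by (induction zs arbitrary: ys) (auto simp: f'_def Cons_eq_map_conv)
    have R: "map f' zs = map Inr ys \<longleftrightarrow> ys = map snd zs \<and> (\<forall>p\<in>set zs. fst p = i)" for zs ys
      by (induction zs arbitrary: ys) (auto simp: f'_def Cons_eq_map_conv)
    have "interp (free_union (copies I M) M) r (map f xs) \<longleftrightarrow>
        (\<forall>p\<in>set xs. fst p \<noteq> i) \<and> (\<forall>p\<in>set xs. \<forall>q\<in>set xs. fst p = fst q) \<and> interp M r (map snd xs) \<or>
        (\<forall>p\<in>set xs. fst p = i) \<and> interp M r (map snd xs)"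
      unfolding free_union_def copies_def rel_structure.simps f_xs L R by blast
    moreover have "interp (copies (insert i I) M) r xs \<longleftrightarrow>
        (\<forall>p\<in>set xs. \<forall>q\<in>set xs. fst p = fst q) \<and> interp M r (map snd xs)"
      by (simp only: copies_def rel_structure.simps)
    moreover have "(\<forall>p\<in>set xs. \<forall>q\<in>set xs. fst p = fst q) \<longrightarrow>
        (\<forall>p\<in>set xs. fst p \<noteq> i) \<or> (\<forall>p\<in>set xs. fst p = i)"
      by blast
    moreover have "(\<forall>p\<in>set xs. fst p = i) \<longrightarrow> (\<forall>p\<in>set xs. \<forall>q\<in>set xs. fst p = fst q)"
      by simp
    ultimately show ?thesis by argo
  qed
  moreover have "inj_on f (insert i I \<times> carr M)"
    by (auto simp: inj_on_def f_def split: if_splits)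
  moreover have "f \<in> insert i I \<times> carr M \<rightarrow>\<^sub>E carr (free_union (copies I M) M)"
    by (auto simp: f_def free_union_def)
  ultimately have "f \<in> embeddings ar (copies (insert i I) M) (free_union (copies I M) M)"
    by (simp add: embeddings_def preserves_rels_def)
  moreover have "in_Age ar F (free_union (copies I M) M)"
    using free_JEP_arbitrary_types[OF F insert.IH M] .
  moreover have "finite (carr (copies (insert i I) M))"
    using insert.hyps M by (simp add: in_Age_def)
  ultimately show ?case by (rule in_Age_if_embeds)
qed

lemma copy_in_embeddings:
  assumes E: "E \<in> embeddings ar (copies I M) F" and i: "i \<in> I"
  shows "(\<lambda>x\<in>carr M. E (i, x)) \<in> embeddings ar M F"
proof -
  have "(\<lambda>x\<in>carr M. (i, x)) \<in> embeddings ar M (copies I M)"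
  proof -
    have "map snd (map (\<lambda>x\<in>carr M. (i, x)) xs) = xs" if "set xs \<subseteq> carr M" for xs
      using that by (auto intro!: map_idI)
    then show ?thesis
      using i by (auto simp: embeddings_def preserves_rels_def copies_def inj_on_def subset_iff)
  qed
  then have "compose (carr M) E (\<lambda>x\<in>carr M. (i, x)) \<in> embeddings ar M F"
    using E by (rule embeddings_compose)
  then show ?thesis by (simp add: compose_def cong: restrict_cong)
qed


section \<open>The Ramsey property\<close>

lemma Aut_bij: "g \<in> Aut ar F \<Longrightarrow> bij g"
  by (auto simp: Aut_def intro: permutes_bij)

text \<open>An automorphism sending a free union of copies of \<open>A\<close> into one of copies of \<open>B\<close> may choose
  on each copy of \<open>A\<close> between \<open>a\<close> and \<open>a'\<close>, so all colour patterns are realised.\<close>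

lemma independence_sets_if_two_colours:
  fixes ar :: "'r \<Rightarrow> nat" and F :: "('r, 'a) rel_structure" and A :: "('r, 'b) rel_structure"
    and B :: "('r, 'c) rel_structure" and Y :: "'y topology"
  defines "G \<equiv> Aut ar F"
  assumes hom: "ultrahomogeneous ar F" and JEP: "free_JEP ar F" and A: "in_Age ar F A"
    and comp: "G_compactification G Y act \<nu>"
    and a0: "a0 \<in> embeddings ar A F"
    and a: "a \<in> embeddings ar A B" and a': "a' \<in> embeddings ar A B"
    and f: "\<And>g. g \<in> G \<Longrightarrow> \<bar>colouring_on_group A a0 c g - f (\<nu> g)\<bar> \<le> \<delta>"
    and two: "\<And>n. \<exists>E\<in>embeddings ar (copies {..<n::nat} B) F. \<forall>i<n.
                c (\<lambda>x\<in>carr A. E (i, a x)) = v \<and> c (\<lambda>x\<in>carr A. E (i, a' x)) = v'"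
    and vv': "v \<noteq> v'"
  shows "\<exists>I. independence_set G act {y \<in> topspace Y. \<bar>f y - v\<bar> \<le> \<delta>}
               {y \<in> topspace Y. \<bar>f y - v'\<bar> \<le> \<delta>} I \<and> finite I \<and> card I = m"
proof -
  have flow: "G_flow G Y act" and emb: "embedding_map (pointwise_topology G) Y \<nu>"
    and equiv: "\<And>g x. \<lbrakk>g \<in> G; x \<in> G\<rbrakk> \<Longrightarrow> act g (\<nu> x) = \<nu> (g \<circ> x)"
    using comp unfolding G_compactification_def by auto
  have \<nu>_in: "\<nu> g \<in> topspace Y" if "g \<in> G" for g
  proof -
    have "topspace (pointwise_topology G) = G"
      by (simp add: pointwise_topology_def)
    then have "\<nu> ` G \<subseteq> topspace Y"
      using homeomorphic_imp_surjective_map[OF emb[unfolded embedding_map_def]]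
      by (metis inf.cobounded1 topspace_subtopology)
    then show ?thesis using that by blast
  qed
  \<comment> \<open>One copy of \<open>A\<close> for each pattern on \<open>m\<close>
    indices.\<close>
  define S where "S = Pow {..<m}"
  have finS: "finite S" by (simp add: S_def)
  obtain \<phi> where \<phi>: "bij_betw \<phi> S {..<card S}"
    using ex_bij_betw_finite_nat[OF finS] by (auto simp: lessThan_atLeast0)
  obtain E where E: "E \<in> embeddings ar (copies {..<card S} B) F"
    and E_col: "\<And>l. l < card S \<Longrightarrow>
      c (\<lambda>x\<in>carr A. E (l, a x)) = v \<and> c (\<lambda>x\<in>carr A. E (l, a' x)) = v'"
    using two[of "card S"] by blast
  have \<phi>_lt: "\<phi> \<sigma> < card S" if "\<sigma> \<in> S" for \<sigma>
    using \<phi> that by (auto simp: bij_betw_def)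
  obtain e0 where e0: "e0 \<in> embeddings ar (copies S A) F"
    using in_Age_copies[OF JEP A finS] unfolding in_Age_def by blast
  have fin: "finite (carr A)" "finite (carr (copies S A))"
    using A finS by (auto simp: in_Age_def)
  \<comment> \<open>The automorphism for index \<open>i\<close> acts on copy \<sigma> through
    \<open>a'\<close> or \<open>a\<close> according to the bit of \<open>i\<close> in \<sigma>, for
    all \<sigma> at once.\<close>
  have "\<exists>g\<in>G. \<forall>p\<in>carr (copies S A). g (e0 p) = E (\<phi> (fst p), (if i \<in> fst p then a' else a) (snd p))"
    for i
  proof -
    have "(\<lambda>p\<in>S \<times> carr A. (\<phi> (fst p), (if i \<in> fst p then a' else a) (snd p)))
        \<in> embeddings ar (copies S A) (copies {..<card S} B)"
      using \<phi> a a' by (intro copies_map_in_embeddings) (auto simp: bij_betw_def)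
    from embeddings_compose[OF this E] obtain g where "g \<in> G"
      "\<forall>p\<in>carr (copies S A). g (e0 p) = compose (carr (copies S A)) E
         (\<lambda>p\<in>S \<times> carr A. (\<phi> (fst p), (if i \<in> fst p then a' else a) (snd p))) p"
      using ultrahomogeneous_extend[OF hom fin(2) e0] unfolding G_def by blast
    then show ?thesis by (auto simp: compose_def intro!: bexI[of _ g])
  qed
  then obtain j where jG: "\<And>i. j i \<in> G" and j: "\<And>i p. p \<in> carr (copies S A) \<Longrightarrow>
      j i (e0 p) = E (\<phi> (fst p), (if i \<in> fst p then a' else a) (snd p))"
    by metis
  \<comment> \<open>These automorphisms carry the base embedding to copy \<sigma>; their images
    under \<nu> are the points realising the patterns.\<close>
  have "\<exists>g\<in>G. \<forall>x\<in>carr A. g (a0 x) = e0 (\<sigma>, x)" if "\<sigma> \<in> S" for \<sigma>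
    using ultrahomogeneous_extend[OF hom fin(1) a0 copy_in_embeddings[OF e0 that]]
    unfolding G_def by simp
  then obtain x where xG: "\<And>\<sigma>. \<sigma> \<in> S \<Longrightarrow> x \<sigma> \<in> G"
    and x: "\<And>\<sigma> z. \<lbrakk>\<sigma> \<in> S; z \<in> carr A\<rbrakk> \<Longrightarrow> x \<sigma> (a0 z) = e0 (\<sigma>, z)"
    by metis
  have col: "colouring_on_group A a0 c (j i \<circ> x \<sigma>) = (if i \<in> \<sigma> then v' else v)"
    if \<sigma>: "\<sigma> \<in> S" for i \<sigma>
  proof -
    have "compose (carr A) (j i \<circ> x \<sigma>) a0 =
        (\<lambda>z\<in>carr A. E (\<phi> \<sigma>, (if i \<in> \<sigma> then a' else a) z))"
      using j x[OF \<sigma>] \<sigma> by (auto simp: compose_def)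
    then show ?thesis
      using E_col[OF \<phi>_lt[OF \<sigma>]] by (simp add: colouring_on_group_def)
  qed
  have G: "bij g \<and> inv g \<in> G" if "g \<in> G" for g
    using that Aut_bij Aut_inv unfolding G_def by blast
  \<comment> \<open>The pattern \<open>{i}\<close> separates \<open>j i\<close> from every other
    \<open>j k\<close>, as the two resulting colours differ.\<close>
  have "inj_on j {..<m}"
  proof (rule inj_onI, rule ccontr)
    fix i k assume ik: "i \<in> {..<m}" "k \<in> {..<m}" "j i = j k" "i \<noteq> k"
    then have "{i} \<in> S" by (simp add: S_def)
    then show False
      using col[of "{i}" i] col[of "{i}" k] ik vv' by simp
  qed
  then have "card (j ` {..<m}) = m" by (simp add: card_image)
  moreover have "independence_set G act {y \<in> topspace Y. \<bar>f y - v\<bar> \<le> \<delta>}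
               {y \<in> topspace Y. \<bar>f y - v'\<bar> \<le> \<delta>} (j ` {..<m})"
  proof (rule independence_setI[OF flow G _ _ jG])
    fix \<rho> assume "\<rho> \<subseteq> {..<m}"
    then have \<rho>: "\<rho> \<in> S" by (simp add: S_def)
    have "act (j i) (\<nu> (x \<rho>)) \<in> (if i \<in> \<rho> then {y \<in> topspace Y. \<bar>f y - v'\<bar> \<le> \<delta>}
            else {y \<in> topspace Y. \<bar>f y - v\<bar> \<le> \<delta>})" for i
    proof -
      have jx: "j i \<circ> x \<rho> \<in> G"
        using Aut_comp jG xG[OF \<rho>] unfolding G_def by blast
      then have "\<bar>f (\<nu> (j i \<circ> x \<rho>)) - (if i \<in> \<rho> then v' else v)\<bar> \<le> \<delta>"
        using f[OF jx] col[OF \<rho>] by (simp add: abs_minus_commute)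
      then show ?thesis
        using equiv[OF jG xG[OF \<rho>]] \<nu>_in[OF jx] by (cases "i \<in> \<rho>") simp_all
    qed
    then show "\<exists>y\<in>topspace Y. \<forall>i<m. act (j i) y \<in> (if i \<in> \<rho> then {y \<in> topspace Y. \<bar>f y - v'\<bar> \<le> \<delta>}
            else {y \<in> topspace Y. \<bar>f y - v\<bar> \<le> \<delta>})"
      using \<nu>_in[OF xG[OF \<rho>]] by blast
  qed auto
  ultimately show ?thesis by blast
qed

text \<open>Values of \<open>f\<close> within \<delta> of \<open>v\<close> and of \<open>v'\<close>
  cannot coincide when these are more than \<open>2 * \<epsilon>\<close> apart, since \<delta> is
  below \<epsilon>; but an IN-pair with such values would exist.\<close>

lemma close_values_if_null:
  fixes F :: "('r, 'a) rel_structure" and c :: "('b \<Rightarrow> 'a) \<Rightarrow> real"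
  assumes hom: "ultrahomogeneous ar F" and JEP: "free_JEP ar F" and A: "in_Age ar F A"
    and a0: "a0 \<in> embeddings ar A F"
    and a: "a \<in> embeddings ar A B" and a': "a' \<in> embeddings ar A B"
    and c: "colouring_on_group A a0 c \<in> thickening (Aut ar F) (null_functions (Aut ar F)) \<epsilon>"
    and \<epsilon>: "\<epsilon> > 0"
    and two: "\<And>n. \<exists>E\<in>embeddings ar (copies {..<n::nat} B) F. \<forall>i<n.
                c (\<lambda>x\<in>carr A. E (i, a x)) = v \<and> c (\<lambda>x\<in>carr A. E (i, a' x)) = v'"
  shows "\<bar>v - v'\<bar> \<le> 2 * \<epsilon>"
proof (rule ccontr)
  assume far: "\<not> ?thesis"
  define G where "G = Aut ar F"
  obtain k where k: "k \<in> null_functions G" and bdd: "bdd_above ((\<lambda>g. \<bar>colouring_on_group A a0 c g - k g\<bar>) ` G)"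
    and sup: "(SUP g\<in>G. \<bar>colouring_on_group A a0 c g - k g\<bar>) < \<epsilon>"
    using c unfolding thickening_def G_def by blast
  \<comment> \<open>The supremum itself is the radius, so the sets \<open>K w\<close> are closed, as
    compactness requires, while \<delta> < \<epsilon> stays strict.\<close>
  define \<delta> where "\<delta> = (SUP g\<in>G. \<bar>colouring_on_group A a0 c g - k g\<bar>)"
  have \<delta>: "\<bar>colouring_on_group A a0 c g - k g\<bar> \<le> \<delta>" if "g \<in> G" for g
    unfolding \<delta>_def using cSUP_upper[OF that bdd] .
  obtain Y :: "('a \<Rightarrow> 'a) set set topology" and act \<nu> where comp: "G_compactification G Y act \<nu>"
    and null: "null_flow G Y act" and "comes_from G k Y \<nu>"
    using k unfolding null_functions_def by blast
  then obtain f where f: "continuous_map Y euclideanreal f" and kf: "\<And>g. g \<in> G \<Longrightarrow> k g = f (\<nu> g)"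
    unfolding comes_from_def by blast
  have flow: "G_flow G Y act"
    using comp unfolding G_compactification_def by blast
  define K where "K w = {y \<in> topspace Y. \<bar>f y - w\<bar> \<le> \<delta>}" for w
  have "K w = {y \<in> topspace Y. f y \<in> {w - \<delta>..w + \<delta>}}" for w
    unfolding K_def by auto
  then have closed: "closedin Y (K w)" for w
    using closedin_continuous_map_preimage[OF f, of "{w - \<delta>..w + \<delta>}"] by simp
  have "\<epsilon> > \<delta>" using sup by (simp add: \<delta>_def)
  have "\<exists>I. independence_set G act (K v) (K v') I \<and> finite I \<and> card I = n" for n
    unfolding K_def G_def
  proof (rule independence_sets_if_two_colours[OF hom JEP A comp[unfolded G_def] a0 a a' _ two])
    show "\<bar>colouring_on_group A a0 c g - f (\<nu> g)\<bar> \<le> \<delta>" if "g \<in> Aut ar F" for g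
      using \<delta> kf that by (simp add: G_def)
    show "v \<noteq> v'"
      using far \<epsilon> by auto
  qed
  moreover have "bij g \<and> inv g \<in> G" if "g \<in> G" for g
    using that Aut_bij Aut_inv unfolding G_def by blast
  ultimately obtain y y' where y: "y \<in> K v" "y' \<in> K v'" "IN_pair G Y act y y'"
    using IN_pair_if_independence_unbounded[OF flow _ closed closed] by blast
  have "f y \<noteq> f y'"
    using y(1,2) far \<open>\<epsilon> > \<delta>\<close> by (auto simp: K_def)
  then show False
    using null f y(3) unfolding null_flow_def by blast
qed

theorem theorem3p6:
  fixes ar :: "'r \<Rightarrow> nat"
    and F :: "('r, 'a) rel_structure"
    and A :: "('r, 'b) rel_structure"
    and B :: "('r, 'c) rel_structure"
    and a0 :: "'b \<Rightarrow> 'a"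
    and C :: "(('b \<Rightarrow> 'a) \<Rightarrow> real) set"
    and \<epsilon> :: real
  assumes "Fraisse_structure ar F"
    and "free_JEP ar F"
    and "\<epsilon> > 0"
    and "in_Age ar F A" and "in_Age ar F B"
    and "a0 \<in> embeddings ar A F"
    and "finite C"
    and "\<forall>c\<in>C. finite_colouring ar A F c"
    and "\<forall>c\<in>C. colouring_on_group A a0 c
           \<in> thickening (Aut ar F) (null_functions (Aut ar F)) \<epsilon>"
  shows "\<exists>h\<in>embeddings ar B F. \<forall>c\<in>C.
           \<forall>a\<in>embeddings ar A B. \<forall>a'\<in>embeddings ar A B.
             \<bar>c (compose (carr A) h a) - c (compose (carr A) h a')\<bar> \<le> 2 * \<epsilon>"
proof (rule ccontr)
  assume none: "\<not> ?thesis"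
  have hom: "ultrahomogeneous ar F"
    using assms(1) by (simp add: Fraisse_structure_def)
  have finAB: "finite (carr A)" "finite (carr B)"
    using assms(4,5) by (simp_all add: in_Age_def)
  define Emb where "Emb = embeddings ar A B"
  define V where "V = (\<Union>c\<in>C. c ` embeddings ar A F)"
  define D where "D = {(c, a, a', v, v'). c \<in> C \<and> a \<in> Emb \<and> a' \<in> Emb \<and> v \<in> V \<and> v' \<in> V \<and>
      \<bar>v - v'\<bar> > 2 * \<epsilon>}"
  have "finite Emb"
  proof (rule finite_subset)
    show "Emb \<subseteq> carr A \<rightarrow>\<^sub>E carr B" by (auto simp: Emb_def embeddings_def)
  qed (use finAB in \<open>simp add: finite_PiE\<close>)
  moreover have "finite V"
    using assms(7,8) by (auto simp: V_def finite_colouring_def)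
  ultimately have "finite (C \<times> Emb \<times> Emb \<times> V \<times> V)"
    using assms(7) by simp
  then have finD: "finite D"
    by (rule finite_subset[rotated]) (auto simp: D_def)
  define sees where "sees h = (\<lambda>(c :: ('b \<Rightarrow> 'a) \<Rightarrow> real, a, a', v, v').
      c (compose (carr A) h a) = v \<and> c (compose (carr A) h a') = v')" for h :: "'c \<Rightarrow> 'a"
  have ex_datum: "\<exists>d\<in>D. sees h d" if h: "h \<in> embeddings ar B F" for h
  proof -
    obtain c a a' where c: "c \<in> C" "a \<in> Emb" "a' \<in> Emb"
      "\<bar>c (compose (carr A) h a) - c (compose (carr A) h a')\<bar> > 2 * \<epsilon>"
      using none h unfolding Emb_def by (auto simp: not_le)
    have "compose (carr A) h a \<in> embeddings ar A F" "compose (carr A) h a' \<in> embeddings ar A F"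
      using c(2,3) h unfolding Emb_def by (auto intro: embeddings_compose)
    then have "(c, a, a', c (compose (carr A) h a), c (compose (carr A) h a')) \<in> D"
      using c by (auto simp: D_def V_def)
    then show ?thesis by (rule bexI[rotated]) (simp add: sees_def)
  qed
  \<comment> \<open>A datum shared by all copies in suitable unions of every size would satisfy
    \<open>close_values_if_null\<close>, although its two colours are far apart.\<close>
  have "\<exists>n::nat. \<forall>E\<in>embeddings ar (copies {..<n} B) F. \<exists>i<n. \<not> sees (\<lambda>x\<in>carr B. E (i, x)) d"
    if d: "d \<in> D" for d
  proof (rule ccontr)
    assume *: "\<not> ?thesis"
    obtain c a a' v v' where d_eq: "d = (c, a, a', v, v')"
      by (cases d) auto
    have mem: "c \<in> C" "a \<in> embeddings ar A B" "a' \<in> embeddings ar A B" "\<bar>v - v'\<bar> > 2 * \<epsilon>"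
      using d by (simp_all add: D_def d_eq Emb_def)
    have restr: "compose (carr A) (\<lambda>x\<in>carr B. E (i, x)) b = (\<lambda>x\<in>carr A. E (i, b x))"
      if "b \<in> embeddings ar A B" for E :: "nat \<times> 'c \<Rightarrow> 'a" and i b
    proof -
      have "b x \<in> carr B" if "x \<in> carr A" for x
        using \<open>b \<in> embeddings ar A B\<close> that by (auto simp: embeddings_def)
      then show ?thesis by (auto simp: compose_def)
    qed
    have "\<exists>E\<in>embeddings ar (copies {..<n} B) F. \<forall>i<n.
        c (\<lambda>x\<in>carr A. E (i, a x)) = v \<and> c (\<lambda>x\<in>carr A. E (i, a' x)) = v'" for n :: nat
    proof -
      obtain E where "E \<in> embeddings ar (copies {..<n} B) F" "\<forall>i<n. sees (\<lambda>x\<in>carr B. E (i, x)) d"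
        using * by blast
      then show ?thesis
        using restr[OF mem(2), of E] restr[OF mem(3), of E]
        by (intro bexI[of _ E]) (simp_all add: sees_def d_eq)
    qed
    then have "\<bar>v - v'\<bar> \<le> 2 * \<epsilon>"
      using assms(9) mem(1) by (intro close_values_if_null[OF hom assms(2,4,6) mem(2,3) _ assms(3)]) blast+
    then show False using mem(4) by simp
  qed
  then have "\<forall>d\<in>D. \<exists>n::nat. \<forall>E\<in>embeddings ar (copies {..<n} B) F.
      \<exists>i<n. \<not> sees (\<lambda>x\<in>carr B. E (i, x)) d"
    by blast
  from bchoice[OF this] obtain N :: "_ \<Rightarrow> nat" where N: "\<And>d E. \<lbrakk>d \<in> D; E \<in> embeddings ar (copies {..<N d} B) F\<rbrakk> \<Longrightarrow>
      \<exists>i<N d. \<not> sees (\<lambda>x\<in>carr B. E (i, x)) d"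
    by blast
  \<comment> \<open>One copy more than all thresholds together, so some datum \<open>d\<close>
    exceeds its threshold \<open>N d\<close>.\<close>
  define M where "M = Suc (\<Sum>d\<in>D. N d)"
  obtain E where E: "E \<in> embeddings ar (copies {..<M} B) F"
    using in_Age_copies[OF assms(2,5), of "{..<M}"] unfolding in_Age_def by blast
  have "\<exists>d\<in>D. sees (\<lambda>x\<in>carr B. E (l, x)) d" if "l < M" for l
    using ex_datum copy_in_embeddings[OF E] that by simp
  then obtain dat where dat: "\<And>l. l < M \<Longrightarrow> dat l \<in> D \<and> sees (\<lambda>x\<in>carr B. E (l, x)) (dat l)"
    by metis
  have "dat ` {..<M} \<subseteq> D" "(\<Sum>d\<in>D. N d) < card {..<M}"
    using dat by (auto simp: M_def)
  then obtain d where d: "d \<in> D" "N d < card {l\<in>{..<M}. dat l = d}"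
    using pigeonhole_sum[OF finite_lessThan[of M] finD] by blast
  then obtain \<phi> where \<phi>: "inj_on \<phi> {..<N d}" "\<phi> ` {..<N d} \<subseteq> {l\<in>{..<M}. dat l = d}"
    using card_le_inj[of "{..<N d}" "{l\<in>{..<M}. dat l = d}"] by auto
  \<comment> \<open>Keeping only \<open>N d\<close> of the copies that see \<open>d\<close> gives an
    embedding excluded by the choice of \<open>N d\<close>.\<close>
  have "(\<lambda>p\<in>{..<N d} \<times> carr B. (\<phi> (fst p), restrict id (carr B) (snd p)))
      \<in> embeddings ar (copies {..<N d} B) (copies {..<M} B)"
    using \<phi> by (intro copies_map_in_embeddings restrict_id_in_embeddings) auto
  from embeddings_compose[OF this E]
  obtain i where i: "i < N d" "\<not> sees (\<lambda>x\<in>carr B. compose (carr (copies {..<N d} B)) E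
      (\<lambda>p\<in>{..<N d} \<times> carr B. (\<phi> (fst p), restrict id (carr B) (snd p))) (i, x)) d"
    using N[OF d(1)] by blast
  moreover have "(\<lambda>x\<in>carr B. compose (carr (copies {..<N d} B)) E
      (\<lambda>p\<in>{..<N d} \<times> carr B. (\<phi> (fst p), restrict id (carr B) (snd p))) (i, x)) =
      (\<lambda>x\<in>carr B. E (\<phi> i, x))"
    using i(1) by (auto simp: compose_def)
  moreover have "\<phi> i < M" "dat (\<phi> i) = d"
    using \<phi>(2) i(1) by auto
  ultimately show False using dat[of "\<phi> i"] by simp
qed

end
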